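(* Let $\mathcal{E}=\{(z,z+1): z\in\mathcal{Z}\}\cup\{(z,0): z\in\mathcal{Z}\setminus\{0\}\}$, and let $\lambda_{z,z'}:\mathcal{M}_1(\mathcal{Z})\to\mathbb{R}_+$, $(z,z')\in\mathcal{E}$, be given transition rates. Assume: (i) there exist positive constants $\overline{\lambda},\underline{\lambda}$ such that, for all $\xi\in\mathcal{M}_1(\mathcal{Z})$, $\frac{\underline{\lambda}}{z+1}\le\lambda_{z,z+1}(\xi)\le\frac{\overline{\lambda}}{z+1}$ for all $z\in\mathcal{Z}$ and $\underline{\lambda}\le\lambda_{z,0}(\xi)\le\overline{\lambda}$ for all $z\in\mathcal{Z}\setminus\{0\}$; (ii) the functions $(z+1)\lambda_{z,z+1}(\cdot)$, $z\in\mathcal{Z}$, and $\lambda_{z,0}(\cdot)$, $z\in\mathcal{Z}\setminus\{0\}$, are uniformly Lipschitz continuous on $(\mathcal{M}_1(\mathcal{Z}),d)$; (iii) the McKean-Vlasov equation $\dot\mu(t)=\Lambda^*_{\mu(t)}\mu(t)$ has a unique globally asymptotically stable equilibrium $\xi^*\in\mathcal{M}_1(\mathcal{Z})$; (iv) $\langle\xi^*,\vartheta\rangle<\infty$ and, for each $M>0$, $\lim_{t\to\infty}\sup_{\nu\in\mathscr{K}_M}\langle\mu_\nu(t),\vartheta\rangle=\langle\xi^*,\vartheta\rangle$. Let $\xi_n\in\mathscr{K}$, $n\ge1$, and $\xi\in\mathscr{K}$. Suppose that $\xi_n\to\xi$ in $\mathcal{M}_1(\mathcal{Z})$ and $\langle\xi_n,\vartheta\rangle\to\langle\xi,\vartheta\rangle$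 as $n\to\infty$. Then $V(\xi_n)\to V(\xi)$ as $n\to\infty$.
   Context: $\mathcal{Z}=\{0,1,2,\dots\}$. $\mathcal{M}_1(\mathcal{Z})$ is the set of probability measures on $\mathcal{Z}$ with the total variation metric $d$. For $\xi\in\mathcal{M}_1(\mathcal{Z})$, $\Lambda_\xi$ is the rate matrix: $\Lambda_\xi(z,z')=\lambda_{z,z'}(\xi)$ if $(z,z')\in\mathcal{E}$, $0$ if $z'\ne z$ and $(z,z')\notin\mathcal{E}$, and $\Lambda_\xi(z,z)=-\sum_{z'\ne z}\lambda_{z,z'}(\xi)$; $\Lambda_\xi^*$ is its transpose. $\mu_\nu$ denotes the solution of the McKean-Vlasov equation $\dot\mu(t)=\Lambda^*_{\mu(t)}\mu(t)$ with $\mu(0)=\nu$. $\vartheta(z)=z\log z$ with $0\log0=0$; $\langle\xi,\vartheta\rangle=\sum_z\xi(z)\vartheta(z)$; $\mathscr{K}_M=\{\xi\in\mathcal{M}_1(\mathcal{Z}):\langle\xi,\vartheta\rangle\le M\}$; $\mathscr{K}=\bigcup_{M\ge1}\mathscr{K}_M$. $D([0,T],\mathcal{M}_1(\mathcal{Z}))$ is the space of right-continuous paths with left limits. Let $C_0(\mathcal{Z})$ be the finitely supported real functions on $\mathcal{Z}$, $\tau(u)=e^u-u-1$. For $\varphi\in D([0,T],\mathcal{M}_1(\mathcal{Z}))$ with $\varphi(0)=\nu$ and $t\mapsto\varphi_t$ absolutely continuous (i.e. each coordinate $t\mapsto\varphi_t(z)$ is absolutely continuous, with derivative $\dot\varphi_t(z)$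 for a.e. $t$), $$S_{[0,T]}(\varphi|\nu)=\int_{[0,T]}\sup_{\alpha\in C_0(\mathcal{Z})}\Big\{\langle\alpha,\dot\varphi_t-\Lambda^*_{\varphi_t}\varphi_t\rangle-\sum_{(z,z')\in\mathcal{E}}\tau(\alpha(z')-\alpha(z))\lambda_{z,z'}(\varphi_t)\varphi_t(z)\Big\}dt,$$ and $S_{[0,T]}(\varphi|\nu)=\infty$ otherwise. The quasipotential is $V(\xi)=\inf\{S_{[0,T]}(\varphi|\xi^* ):\varphi(0)=\xi^*,\ \varphi(T)=\xi,\ T>0\}$, the infimum being over all $T>0$ and $\varphi\in D([0,T],\mathcal{M}_1(\mathcal{Z}))$. *)

theory Defs
  imports "HOL-Probability.Probability"
begin

text \<open>Probability measures on the nonnegative integers are elements of \<^typ>\<open>nat pmf\<close>.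
  Rates have type \<^typ>\<open>nat \<Rightarrow> nat \<Rightarrow> nat pmf \<Rightarrow> real\<close>; \<open>lam z z' \<xi>\<close> is meaningful only if
  \<open>(z, z') \<in> edges\<close>, and the definitions below never look at its other values.\<close>

definition tv_dist :: "'a pmf \<Rightarrow> 'a pmf \<Rightarrow> real" where
  "tv_dist \<xi> \<eta> = (SUP A. \<bar>measure_pmf.prob \<xi> A - measure_pmf.prob \<eta> A\<bar>)"

definition tv_tendsto :: "('b \<Rightarrow> 'a pmf) \<Rightarrow> 'a pmf \<Rightarrow> 'b filter \<Rightarrow> bool" where
  "tv_tendsto f \<xi> F \<longleftrightarrow> ((\<lambda>x. tv_dist (f x) \<xi>) \<longlongrightarrow> 0) F"

definition edges :: "(nat \<times> nat) set" where
  "edges = {(z, z + 1) | z. True} \<union> {(z, 0) | z. z \<noteq> 0}"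

definition rate_matrix :: "(nat \<Rightarrow> nat \<Rightarrow> nat pmf \<Rightarrow> real) \<Rightarrow> nat pmf \<Rightarrow> nat \<Rightarrow> nat \<Rightarrow> real" where
  "rate_matrix lam \<xi> z z' =
    (if z' = z then - (\<Sum>y | y \<noteq> z \<and> (z, y) \<in> edges. lam z y \<xi>)
     else if (z, z') \<in> edges then lam z z' \<xi> else 0)"

text \<open>\<open>mv_drift lam \<xi>\<close> is \<open>\<Lambda>\<^sub>\<xi>\<^sup>* \<xi>\<close>.\<close>

definition mv_drift :: "(nat \<Rightarrow> nat \<Rightarrow> nat pmf \<Rightarrow> real) \<Rightarrow> nat pmf \<Rightarrow> nat \<Rightarrow> real" where
  "mv_drift lam \<xi> z = (\<Sum>\<^sub>\<infinity>z'. rate_matrix lam \<xi> z' z * pmf \<xi> z')"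

text \<open>Solutions on \<open>[0, \<infinity>)\<close> with initial condition \<open>\<nu>\<close>; values at negative times are
  irrelevant. For bounded, uniformly Lipschitz rates the solution exists and is unique on
  \<open>[0, \<infinity>)\<close>, so "the solution" and "every solution" agree.\<close>

definition mv_solutions :: "(nat \<Rightarrow> nat \<Rightarrow> nat pmf \<Rightarrow> real) \<Rightarrow> nat pmf \<Rightarrow> (real \<Rightarrow> nat pmf) set" where
  "mv_solutions lam \<nu> = {\<mu>. \<mu> 0 = \<nu> \<and>
     (\<forall>t\<ge>0. \<forall>z. ((\<lambda>s. pmf (\<mu> s) z) has_real_derivative mv_drift lam (\<mu> t) z) (at t within {0..}))}"

definition mv_equilibrium :: "(nat \<Rightarrow> nat \<Rightarrow> nat pmf \<Rightarrow> real) \<Rightarrow> nat pmf \<Rightarrow> bool" where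
  "mv_equilibrium lam \<xi> \<longleftrightarrow> (\<forall>z. mv_drift lam \<xi> z = 0)"

text \<open>Globally asymptotically stable: Lyapunov stable and attracting every initial condition.\<close>

definition glob_asymp_stable_equilibrium ::
    "(nat \<Rightarrow> nat \<Rightarrow> nat pmf \<Rightarrow> real) \<Rightarrow> nat pmf \<Rightarrow> bool" where
  "glob_asymp_stable_equilibrium lam \<xi> \<longleftrightarrow>
     mv_equilibrium lam \<xi> \<and>
     (\<forall>\<epsilon>>0. \<exists>\<delta>>0. \<forall>\<nu>. tv_dist \<nu> \<xi> < \<delta> \<longrightarrow>
        (\<forall>\<mu>\<in>mv_solutions lam \<nu>. \<forall>t\<ge>0. tv_dist (\<mu> t) \<xi> < \<epsilon>)) \<and>
     (\<forall>\<nu>. \<forall>\<mu>\<in>mv_solutions lam \<nu>. tv_tendsto \<mu> \<xi> at_top)"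

text \<open>The convention \<open>0 log 0 = 0\<close> needs no case distinction.\<close>

definition vartheta :: "nat \<Rightarrow> real" where
  "vartheta z = real z * ln (real z)"

definition vartheta_mean :: "nat pmf \<Rightarrow> ennreal" where
  "vartheta_mean \<xi> = (\<integral>\<^sup>+z. ennreal (vartheta z) \<partial>measure_pmf \<xi>)"

definition K_level :: "real \<Rightarrow> nat pmf set" where
  "K_level M = {\<xi>. vartheta_mean \<xi> \<le> ennreal M}"

definition K_set :: "nat pmf set" where
  "K_set = (\<Union>M\<in>{1..}. K_level M)"

text \<open>A path on \<open>[0, T]\<close> is a function on all of \<open>\<real>\<close> of which only the values on \<open>[0, T]\<close> matter.\<close>

definition skorokhod_paths :: "real \<Rightarrow> (real \<Rightarrow> nat pmf) set" where
  "skorokhod_paths T = {\<phi>.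
     (\<forall>t. 0 \<le> t \<and> t < T \<longrightarrow> tv_tendsto \<phi> (\<phi> t) (at_right t)) \<and>
     (\<forall>t. 0 < t \<and> t \<le> T \<longrightarrow> (\<exists>\<xi>. tv_tendsto \<phi> \<xi> (at_left t)))}"

definition abs_cont_on :: "real \<Rightarrow> real \<Rightarrow> (real \<Rightarrow> real) \<Rightarrow> bool" where
  "abs_cont_on a b f \<longleftrightarrow> (\<forall>\<epsilon>>0. \<exists>\<delta>>0. \<forall>P.
     finite P \<and> (\<forall>(u, v)\<in>P. a \<le> u \<and> u < v \<and> v \<le> b) \<and>
     pairwise (\<lambda>p q. {fst p<..<snd p} \<inter> {fst q<..<snd q} = {}) P \<and>
     (\<Sum>(u, v)\<in>P. v - u) < \<delta> \<longrightarrow> (\<Sum>(u, v)\<in>P. \<bar>f v - f u\<bar>) < \<epsilon>)"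

definition fin_supp_funs :: "(nat \<Rightarrow> real) set" where
  "fin_supp_funs = {\<alpha>. finite {z. \<alpha> z \<noteq> 0}}"

definition tau :: "real \<Rightarrow> real" where
  "tau u = exp u - u - 1"

text \<open>\<open>local_rate lam \<xi> \<psi>\<close> is the integrand of the action at a time at which the path is at \<open>\<xi>\<close> and
  has velocity \<open>\<psi>\<close>. It is nonnegative, as \<open>\<alpha> = 0\<close> is admissible, so that no information is lost
  by \<^const>\<open>e2ennreal\<close> in the definition of the action.\<close>

definition local_rate ::
    "(nat \<Rightarrow> nat \<Rightarrow> nat pmf \<Rightarrow> real) \<Rightarrow> nat pmf \<Rightarrow> (nat \<Rightarrow> real) \<Rightarrow> ereal" where
  "local_rate lam \<xi> \<psi> = (SUP \<alpha>\<in>fin_supp_funs. ereal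
     ((\<Sum>z | \<alpha> z \<noteq> 0. \<alpha> z * (\<psi> z - mv_drift lam \<xi> z))
      - (\<Sum>\<^sub>\<infinity>(z, z')\<in>edges. tau (\<alpha> z' - \<alpha> z) * lam z z' \<xi> * pmf \<xi> z)))"

text \<open>Absolutely continuous coordinates are differentiable almost everywhere on \<open>[0, T]\<close>; the
  arbitrary value of \<^const>\<open>deriv\<close> on the exceptional null set does not affect the integral.\<close>

definition action ::
    "(nat \<Rightarrow> nat \<Rightarrow> nat pmf \<Rightarrow> real) \<Rightarrow> real \<Rightarrow> nat pmf \<Rightarrow> (real \<Rightarrow> nat pmf) \<Rightarrow> ennreal" where
  "action lam T \<nu> \<phi> =
    (if \<phi> 0 = \<nu> \<and> (\<forall>z. abs_cont_on 0 T (\<lambda>t. pmf (\<phi> t) z))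
     then \<integral>\<^sup>+t\<in>{0..T}. e2ennreal (local_rate lam (\<phi> t) (\<lambda>z. deriv (\<lambda>s. pmf (\<phi> s) z) t)) \<partial>lebesgue
     else \<infinity>)"

definition quasipotential ::
    "(nat \<Rightarrow> nat \<Rightarrow> nat pmf \<Rightarrow> real) \<Rightarrow> nat pmf \<Rightarrow> nat pmf \<Rightarrow> ennreal" where
  "quasipotential lam \<xi>s \<xi> =
    Inf {action lam T \<xi>s \<phi> | T \<phi>. T > 0 \<and> \<phi> \<in> skorokhod_paths T \<and> \<phi> 0 = \<xi>s \<and> \<phi> T = \<xi>}"

end

theory Submission
  imports Defs
begin

text \<open>
  Paths can be concatenated, so \<open>V(\<eta>) \<le> V(\<nu>) + c(\<nu>, \<eta>)\<close> with \<open>c(\<nu>, \<eta>)\<close> the cost of steering \<open>\<nu>\<close> to \<open>\<eta>\<close>, and it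
  suffices that \<open>c(\<xi>n, \<xi>)\<close> and \<open>c(\<xi>, \<xi>n)\<close> tend to 0; no lower semicontinuity of the action is
  needed. To steer \<open>\<nu>\<close> to \<open>\<eta>\<close> within a short time \<open>T\<close>, first drop the excess mass \<open>(\<nu> - \<eta>)\<^sup>+\<close> to 0; then
  push, one edge \<open>(k, k + 1)\<close> after the other, the mass \<open>\<Sum>i>k. (\<eta> - \<nu>)\<^sup>+ i\<close> that is missing beyond \<open>k\<close>.
  Giving the \<open>j\<close>-th stage the time \<open>T / ((j + 1) * (j + 2))\<close>, its cost per unit of mass is of order \<open>ln j\<close>,
  because the rate of the edge is of order \<open>1 / j\<close>. The total cost is thus at most
  \<open>C * T + C(T) * (\<Sum>z. \<bar>\<nu> z - \<eta> z\<bar> * (1 + vartheta z))\<close>, and this weighted distance between \<open>\<xi>n\<close> and \<open>\<xi>\<close> tends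
  to 0 by Scheffe's lemma.
\<close>

section \<open>Total variation, absolute continuity and lower integrals\<close>

lemma pmf_sums_1: "pmf (p :: nat pmf) sums 1"
proof -
  have "((\<lambda>z. ennreal (pmf p z)) sums ennreal 1)"
    using nn_integral_pmf_eq_1[of p] nn_integral_count_space_nat[of "\<lambda>z. ennreal (pmf p z)"]
    by (simp add: sums_iff)
  then show ?thesis
    by (subst (asm) sums_ennreal) auto
qed

lemma bdd_above_tv_dist: "bdd_above (range (\<lambda>A. \<bar>measure_pmf.prob p A - measure_pmf.prob q A\<bar>))"
proof (rule bdd_aboveI2)
  fix A
  show "\<bar>measure_pmf.prob p A - measure_pmf.prob q A\<bar> \<le> 1"
    using measure_pmf.prob_le_1[of p A] measure_pmf.prob_le_1[of q A]
      measure_nonneg[of "measure_pmf p" A] measure_nonneg[of "measure_pmf q" A] by linarith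
qed

lemma abs_pmf_diff_le_tv_dist: "\<bar>pmf p z - pmf q z\<bar> \<le> tv_dist p q"
  unfolding tv_dist_def pmf.rep_eq by (rule cSUP_upper[OF _ bdd_above_tv_dist]) simp

lemma tv_dist_nonneg: "0 \<le> tv_dist p q"
  using abs_pmf_diff_le_tv_dist[of p undefined q] by linarith

text \<open>Both measures have total mass 1, so the mass of \<open>p\<close> outside
  \<open>S\<close> is that of \<open>q\<close> outside \<open>S\<close> up to the sum over
  \<open>S\<close>. Hence only the tail of \<open>q\<close> appears, which stays fixed when
  \<open>p\<close> varies.\<close>

lemma tv_dist_le_finite:
  assumes "finite S"
  shows "tv_dist p q \<le> 2 * (\<Sum>z\<in>S. \<bar>pmf p z - pmf q z\<bar>) + 2 * measure_pmf.prob q (- S)"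
  unfolding tv_dist_def
proof (rule cSUP_least)
  fix A
  let ?d = "\<Sum>z\<in>S. \<bar>pmf p z - pmf q z\<bar>"
  have split: "measure_pmf.prob r A = (\<Sum>z\<in>A \<inter> S. pmf r z) + measure_pmf.prob r (A - S)" for r
  proof -
    have "measure_pmf.prob r A = measure_pmf.prob r ((A \<inter> S) \<union> (A - S))"
      by (simp add: Int_Diff_Un)
    also have "\<dots> = measure_pmf.prob r (A \<inter> S) + measure_pmf.prob r (A - S)"
      by (rule measure_pmf.finite_measure_Union) auto
    finally show ?thesis
      using assms by (simp add: measure_measure_pmf_finite)
  qed
  have tail: "measure_pmf.prob r (- S) = 1 - (\<Sum>z\<in>S. pmf r z)" for r
    using assms measure_pmf.prob_compl[of S r]
    by (simp only: space_measure_pmf sets_measure_pmf UNIV_I flip: Compl_eq_Diff_UNIV)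
      (simp add: measure_measure_pmf_finite)
  have le: "measure_pmf.prob r (A - S) \<le> measure_pmf.prob r (- S)" for r
    by (rule measure_pmf.finite_measure_mono) auto
  have d1: "\<bar>(\<Sum>z\<in>S. pmf p z) - (\<Sum>z\<in>S. pmf q z)\<bar> \<le> ?d"
    by (simp add: sum_subtractf[symmetric] sum_abs)
  have "\<bar>(\<Sum>z\<in>A \<inter> S. pmf p z) - (\<Sum>z\<in>A \<inter> S. pmf q z)\<bar> \<le> (\<Sum>z\<in>A \<inter> S. \<bar>pmf p z - pmf q z\<bar>)"
    by (simp add: sum_subtractf[symmetric] sum_abs)
  also have "\<dots> \<le> ?d"
    using assms by (intro sum_mono2) auto
  finally show "\<bar>measure_pmf.prob p A - measure_pmf.prob q A\<bar> \<le> 2 * ?d + 2 * measure_pmf.prob q (- S)"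
    using split[of p] split[of q] tail[of p] tail[of q] le[of p] le[of q] d1
      measure_nonneg[of p "A - S"] measure_nonneg[of q "A - S"] by linarith
qed simp

text \<open>A finite set carrying almost all of the limit \<xi> reduces total variation to finitely
  many coordinates. This lets path regularity be checked one coordinate at a time.\<close>

lemma tv_tendsto_iff_pmf:
  fixes \<xi> :: "nat pmf"
  shows "tv_tendsto f \<xi> F \<longleftrightarrow> (\<forall>z. ((\<lambda>x. pmf (f x) z) \<longlongrightarrow> pmf \<xi> z) F)"
proof
  assume "tv_tendsto f \<xi> F"
  then have "((\<lambda>x. tv_dist (f x) \<xi>) \<longlongrightarrow> 0) F"
    by (simp add: tv_tendsto_def)
  then show "\<forall>z. ((\<lambda>x. pmf (f x) z) \<longlongrightarrow> pmf \<xi> z) F"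
    by (intro allI, rule_tac LIM_zero_cancel, rule_tac Lim_null_comparison[where g = "\<lambda>x. tv_dist (f x) \<xi>"])
      (auto intro!: always_eventually simp: abs_pmf_diff_le_tv_dist)
next
  assume *: "\<forall>z. ((\<lambda>x. pmf (f x) z) \<longlongrightarrow> pmf \<xi> z) F"
  show "tv_tendsto f \<xi> F"
    unfolding tv_tendsto_def
  proof (rule tendstoI)
    fix e :: real assume e: "0 < e"
    have "(\<lambda>n. \<Sum>z<n. pmf \<xi> z) \<longlonglongrightarrow> 1"
      using pmf_sums_1[of \<xi>] by (simp add: sums_def)
    then have "\<forall>\<^sub>F n in sequentially. 1 - e / 4 < (\<Sum>z<n. pmf \<xi> z)"
      using e by (intro order_tendstoD(1)) auto
    then obtain n where "1 - e / 4 < (\<Sum>z<n. pmf \<xi> z)"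
      by (meson eventually_sequentially order_refl)
    then have tail: "measure_pmf.prob \<xi> (- {..<n}) < e / 4"
      using measure_pmf.prob_compl[of "{..<n}" \<xi>]
      by (simp only: space_measure_pmf sets_measure_pmf UNIV_I flip: Compl_eq_Diff_UNIV)
        (simp add: measure_measure_pmf_finite)
    have "((\<lambda>x. \<Sum>z<n. \<bar>pmf (f x) z - pmf \<xi> z\<bar>) \<longlongrightarrow> (\<Sum>z<n. \<bar>pmf \<xi> z - pmf \<xi> z\<bar>)) F"
      using * by (intro tendsto_intros) auto
    then have "\<forall>\<^sub>F x in F. (\<Sum>z<n. \<bar>pmf (f x) z - pmf \<xi> z\<bar>) < e / 4"
      using e by (intro order_tendstoD(2)) auto
    then show "\<forall>\<^sub>F x in F. dist (tv_dist (f x) \<xi>) 0 < e"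
    proof eventually_elim
      case (elim x)
      then show ?case
        using tv_dist_le_finite[of "{..<n}" "f x" \<xi>] tail tv_dist_nonneg[of "f x" \<xi>] e by simp
    qed
  qed
qed

section \<open>Absolute continuity under sums and monotone time changes\<close>

definition nonoverlapping :: "real \<Rightarrow> real \<Rightarrow> (real \<times> real) set \<Rightarrow> bool" where
  "nonoverlapping a b P \<longleftrightarrow> finite P \<and> (\<forall>(u, v)\<in>P. a \<le> u \<and> u < v \<and> v \<le> b) \<and>
     pairwise (\<lambda>p q. {fst p<..<snd p} \<inter> {fst q<..<snd q} = {}) P"

lemma abs_cont_on_iff:
  "abs_cont_on a b f \<longleftrightarrow> (\<forall>e>0. \<exists>d>0. \<forall>P. nonoverlapping a b P \<and> (\<Sum>(u, v)\<in>P. v - u) < d \<longrightarrow>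
     (\<Sum>(u, v)\<in>P. \<bar>f v - f u\<bar>) < e)"
  unfolding abs_cont_on_def nonoverlapping_def conj_assoc ..

lemma abs_cont_on_add:
  assumes "abs_cont_on a b f" "abs_cont_on a b g"
  shows "abs_cont_on a b (\<lambda>x. f x + g x)"
  unfolding abs_cont_on_iff
proof (intro allI impI)
  fix e :: real assume e: "0 < e"
  obtain d1 where d1: "d1 > 0" and 1: "\<And>P. nonoverlapping a b P \<and> (\<Sum>(u, v)\<in>P. v - u) < d1 \<Longrightarrow> (\<Sum>(u, v)\<in>P. \<bar>f v - f u\<bar>) < e / 2"
    using assms(1) half_gt_zero[OF e] unfolding abs_cont_on_iff by meson
  obtain d2 where d2: "d2 > 0" and 2: "\<And>P. nonoverlapping a b P \<and> (\<Sum>(u, v)\<in>P. v - u) < d2 \<Longrightarrow> (\<Sum>(u, v)\<in>P. \<bar>g v - g u\<bar>) < e / 2"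
    using assms(2) half_gt_zero[OF e] unfolding abs_cont_on_iff by meson
  show "\<exists>d>0. \<forall>P. nonoverlapping a b P \<and> (\<Sum>(u, v)\<in>P. v - u) < d \<longrightarrow> (\<Sum>(u, v)\<in>P. \<bar>f v + g v - (f u + g u)\<bar>) < e"
  proof (intro exI[of _ "min d1 d2"] conjI allI impI)
    fix P :: "(real \<times> real) set"
    assume P: "nonoverlapping a b P \<and> (\<Sum>(u, v)\<in>P. v - u) < min d1 d2"
    have "(\<Sum>(u, v)\<in>P. \<bar>f v + g v - (f u + g u)\<bar>)
        \<le> (\<Sum>(u, v)\<in>P. \<bar>f v - f u\<bar> + \<bar>g v - g u\<bar>)"
      by (intro sum_mono) auto
    also have "\<dots> = (\<Sum>(u, v)\<in>P. \<bar>f v - f u\<bar>) + (\<Sum>(u, v)\<in>P. \<bar>g v - g u\<bar>)"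
      by (simp add: sum.distrib split_def)
    also have "\<dots> < e"
      using 1[of P] 2[of P] P by simp
    finally show "(\<Sum>(u, v)\<in>P. \<bar>f v + g v - (f u + g u)\<bar>) < e" .
  qed (use d1 d2 in auto)
qed

lemma abs_cont_on_lipschitz:
  assumes "\<And>u v. a \<le> u \<Longrightarrow> u < v \<Longrightarrow> v \<le> b \<Longrightarrow> \<bar>f v - f u\<bar> \<le> C * (v - u)"
  shows "abs_cont_on a b f"
  unfolding abs_cont_on_iff
proof (intro allI impI)
  fix e :: real assume e: "0 < e"
  show "\<exists>d>0. \<forall>P. nonoverlapping a b P \<and> (\<Sum>(u, v)\<in>P. v - u) < d \<longrightarrow> (\<Sum>(u, v)\<in>P. \<bar>f v - f u\<bar>) < e"
  proof (intro exI[of _ "e / (\<bar>C\<bar> + 1)"] conjI allI impI)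
    fix P :: "(real \<times> real) set"
    assume P: "nonoverlapping a b P \<and> (\<Sum>(u, v)\<in>P. v - u) < e / (\<bar>C\<bar> + 1)"
    have "(\<Sum>(u, v)\<in>P. \<bar>f v - f u\<bar>) \<le> (\<Sum>(u, v)\<in>P. (\<bar>C\<bar> + 1) * (v - u))"
    proof (intro sum_mono, clarify)
      fix u v assume "(u, v) \<in> P"
      then have uv: "a \<le> u" "u < v" "v \<le> b" using P by (auto simp: nonoverlapping_def)
      have "C * (v - u) \<le> (\<bar>C\<bar> + 1) * (v - u)"
        using uv by (intro mult_right_mono) auto
      then show "\<bar>f v - f u\<bar> \<le> (\<bar>C\<bar> + 1) * (v - u)"
        using assms[OF uv] by linarith
    qed
    also have "\<dots> = (\<bar>C\<bar> + 1) * (\<Sum>(u, v)\<in>P. v - u)"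
      by (simp add: sum_distrib_left split_def)
    also have "\<dots> < e"
      using P by (simp add: field_simps)
    finally show "(\<Sum>(u, v)\<in>P. \<bar>f v - f u\<bar>) < e" .
  qed (use e in auto)
qed

text \<open>A monotone map that does not expand distances sends non-overlapping intervals to
  non-overlapping ones of no larger total length. It is applied to maps that freeze a path before or
  after a given time.\<close>

lemma abs_cont_on_compose:
  assumes f: "abs_cont_on c d f"
    and range: "\<And>u. a \<le> u \<Longrightarrow> u \<le> b \<Longrightarrow> c \<le> g u \<and> g u \<le> d"
    and mono: "\<And>u v. u \<le> v \<Longrightarrow> g u \<le> g v"
    and lip: "\<And>u v. u \<le> v \<Longrightarrow> g v - g u \<le> v - u"
  shows "abs_cont_on a b (\<lambda>t. f (g t))"
  unfolding abs_cont_on_iff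
proof (intro allI impI)
  fix e :: real assume e: "0 < e"
  obtain \<delta> where \<delta>: "\<delta> > 0" and 1: "\<And>P. nonoverlapping c d P \<and> (\<Sum>(u, v)\<in>P. v - u) < \<delta> \<Longrightarrow> (\<Sum>(u, v)\<in>P. \<bar>f v - f u\<bar>) < e"
    using f e unfolding abs_cont_on_iff by meson
  show "\<exists>\<delta>>0. \<forall>P. nonoverlapping a b P \<and> (\<Sum>(u, v)\<in>P. v - u) < \<delta> \<longrightarrow> (\<Sum>(u, v)\<in>P. \<bar>f (g v) - f (g u)\<bar>) < e"
  proof (intro exI[of _ \<delta>] conjI allI impI \<delta>)
    fix P :: "(real \<times> real) set"
    assume "nonoverlapping a b P \<and> (\<Sum>(u, v)\<in>P. v - u) < \<delta>"
    then have fin: "finite P" and P: "\<And>u v. (u, v) \<in> P \<Longrightarrow> a \<le> u \<and> u < v \<and> v \<le> b"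
      and disj: "\<And>p q. p \<in> P \<Longrightarrow> q \<in> P \<Longrightarrow> p \<noteq> q \<Longrightarrow> {fst p<..<snd p} \<inter> {fst q<..<snd q} = {}"
      and small: "(\<Sum>(u, v)\<in>P. v - u) < \<delta>"
      by (auto simp: pairwise_def nonoverlapping_def)
    define h where "h = (\<lambda>p. (g (fst p), g (snd p)))"
    \<comment> \<open>Intervals that \<open>g\<close> collapses to a point are discarded: they
      contribute nothing to the sum, and \<open>nonoverlapping\<close> admits only intervals of
      positive length. On the remaining ones \<open>h\<close> is injective.\<close>
    define Q where "Q = {p \<in> P. g (fst p) < g (snd p)}"
    have order: "snd p \<le> fst q \<or> snd q \<le> fst p" if "p \<in> P" "q \<in> P" "p \<noteq> q" for p q
    proof (rule ccontr)
      assume "\<not> ?thesis"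
      then have "max (fst p) (fst q) < min (snd p) (snd q)"
        using P[of "fst p" "snd p"] P[of "fst q" "snd q"] that by auto
      then obtain x where "max (fst p) (fst q) < x" "x < min (snd p) (snd q)"
        using dense by blast
      then have "x \<in> {fst p<..<snd p} \<inter> {fst q<..<snd q}" by simp
      then show False using disj[OF that] by blast
    qed
    have gorder: "g (snd p) \<le> g (fst q) \<or> g (snd q) \<le> g (fst p)" if "p \<in> Q" "q \<in> Q" "p \<noteq> q" for p q
      using order[of p q] that mono by (auto simp: Q_def)
    have inj: "inj_on h Q"
    proof (rule inj_onI, rule ccontr)
      fix p q assume "p \<in> Q" "q \<in> Q" "h p = h q" "p \<noteq> q"
      then show False
        using gorder[of p q] by (auto simp: h_def Q_def)
    qed
    have "(\<Sum>(u, v)\<in>P. \<bar>f (g v) - f (g u)\<bar>) = (\<Sum>(u, v)\<in>Q. \<bar>f (g v) - f (g u)\<bar>)"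
    proof (rule sum.mono_neutral_right[OF fin])
      show "\<forall>i\<in>P - Q. (case i of (u, v) \<Rightarrow> \<bar>f (g v) - f (g u)\<bar>) = 0"
      proof clarify
        fix u v assume "(u, v) \<in> P" "(u, v) \<notin> Q"
        then have "g u = g v"
          using mono[of u v] P[of u v] by (auto simp: Q_def)
        then show "\<bar>f (g v) - f (g u)\<bar> = 0" by simp
      qed
    qed (auto simp: Q_def)
    also have "\<dots> = (\<Sum>(u, v)\<in>h ` Q. \<bar>f v - f u\<bar>)"
      by (subst sum.reindex[OF inj]) (simp add: h_def split_def)
    also have "\<dots> < e"
    proof (rule 1, intro conjI)
      have "finite (h ` Q)" using fin by (simp add: Q_def)
      moreover have "\<forall>(u, v)\<in>h ` Q. c \<le> u \<and> u < v \<and> v \<le> d"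
      proof (clarsimp simp: h_def)
        fix u v u' v' assume uv: "(u', v') \<in> Q" 
        then have "a \<le> u' \<and> u' < v' \<and> v' \<le> b" using P by (auto simp: Q_def)
        then show "c \<le> g u' \<and> g u' < g v' \<and> g v' \<le> d"
          using uv range[of u'] range[of v'] by (auto simp: Q_def)
      qed
      moreover have "pairwise (\<lambda>p q. {fst p<..<snd p} \<inter> {fst q<..<snd q} = {}) (h ` Q)"
      proof (rule pairwiseI)
        fix x y assume "x \<in> h ` Q" "y \<in> h ` Q" "x \<noteq> y"
        then obtain p q where "p \<in> Q" "q \<in> Q" "x = h p" "y = h q" "p \<noteq> q" by auto
        then show "{fst x<..<snd x} \<inter> {fst y<..<snd y} = {}"
          using gorder[of p q] by (auto simp: h_def)
      qed
      ultimately show "nonoverlapping c d (h ` Q)"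
        unfolding nonoverlapping_def by blast
      have "(\<Sum>(u, v)\<in>h ` Q. v - u) = (\<Sum>(u, v)\<in>Q. g v - g u)"
        by (subst sum.reindex[OF inj]) (simp add: h_def split_def)
      also have "\<dots> \<le> (\<Sum>(u, v)\<in>Q. v - u)"
        using P by (intro sum_mono) (auto simp: Q_def less_imp_le intro!: lip)
      also have "\<dots> \<le> (\<Sum>(u, v)\<in>P. v - u)"
        using P by (intro sum_mono2 fin) (auto simp: Q_def less_imp_le)
      finally show "(\<Sum>(u, v)\<in>h ` Q. v - u) < \<delta>"
        using small by linarith
    qed
    finally show "(\<Sum>(u, v)\<in>P. \<bar>f (g v) - f (g u)\<bar>) < e" .
  qed
qed

text \<open>The integrand of the action is a supremum over an uncountable family, so additivity and
  translation of the integral are needed, as inequalities, without measurability of the integrand.\<close>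

lemma nn_integral_Un_le:
  assumes "A \<in> sets M" "B \<in> sets M" "A \<inter> B = {}"
  shows "(\<integral>\<^sup>+x\<in>A \<union> B. f x \<partial>M) \<le> (\<integral>\<^sup>+x\<in>A. f x \<partial>M) + (\<integral>\<^sup>+x\<in>B. f x \<partial>M)"
\<comment> \<open>The integral is a supremum over simple functions below the integrand. Each of
  these is measurable, so ordinary additivity applies to it, and it is compared with
  \<open>f\<close> only afterwards.\<close>
proof (subst (1) nn_integral_def, rule SUP_least)
  fix g assume "g \<in> {g. simple_function M g \<and> g \<le> (\<lambda>x. f x * indicator (A \<union> B) x)}"
  then have g: "simple_function M g" and le: "\<And>x. g x \<le> f x * indicator (A \<union> B) x"
    by (auto simp: le_fun_def)
  have [measurable]: "g \<in> borel_measurable M" "A \<in> sets M" "B \<in> sets M"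
    using g assms by (auto intro: borel_measurable_simple_function)
  have "integral\<^sup>S M g = (\<integral>\<^sup>+x. g x \<partial>M)"
    by (rule nn_integral_eq_simple_integral[symmetric, OF g])
  also have "\<dots> = (\<integral>\<^sup>+x. g x * indicator A x + g x * indicator B x \<partial>M)"
  proof (rule nn_integral_cong)
    fix x
    have "g x = 0" if "x \<notin> A \<union> B"
      using le[of x] that by simp
    then show "g x = g x * indicator A x + g x * indicator B x"
      using assms(3) by (auto simp: indicator_def)
  qed
  also have "\<dots> = (\<integral>\<^sup>+x\<in>A. g x \<partial>M) + (\<integral>\<^sup>+x\<in>B. g x \<partial>M)"
    by (rule nn_integral_add) auto
  also have "\<dots> \<le> (\<integral>\<^sup>+x\<in>A. f x \<partial>M) + (\<integral>\<^sup>+x\<in>B. f x \<partial>M)"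
  proof (intro add_mono nn_integral_mono)
    fix x
    show "g x * indicator A x \<le> f x * indicator A x" "g x * indicator B x \<le> f x * indicator B x"
      using le[of x] by (auto simp: indicator_def)
  qed
  finally show "integral\<^sup>S M g \<le> (\<integral>\<^sup>+x\<in>A. f x \<partial>M) + (\<integral>\<^sup>+x\<in>B. f x \<partial>M)" .
qed

lemma nn_integral_lebesgue_shift_le:
  fixes f :: "real \<Rightarrow> ennreal"
  shows "(\<integral>\<^sup>+x. f x \<partial>lebesgue) \<le> (\<integral>\<^sup>+x. f (c + x) \<partial>lebesgue)"
\<comment> \<open>Again translation invariance is used for a simple minorant only.\<close>
proof (subst (1) nn_integral_def, rule SUP_least)
  fix g assume "g \<in> {g. simple_function lebesgue g \<and> g \<le> f}"
  then have g: "simple_function lebesgue g" and le: "\<And>x. g x \<le> f x"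
    by (auto simp: le_fun_def)
  have gm: "g \<in> borel_measurable lebesgue"
    using g by (auto intro: borel_measurable_simple_function)
  have "integral\<^sup>S lebesgue g = (\<integral>\<^sup>+x. g x \<partial>lebesgue)"
    by (rule nn_integral_eq_simple_integral[symmetric, OF g])
  also have "\<dots> = (\<integral>\<^sup>+x. g (c + x) \<partial>lebesgue)"
    using nn_integral_real_affine_lebesgue[OF gm, of 1 c] by simp
  also have "\<dots> \<le> (\<integral>\<^sup>+x. f (c + x) \<partial>lebesgue)"
    using le by (intro nn_integral_mono)
  finally show "integral\<^sup>S lebesgue g \<le> (\<integral>\<^sup>+x. f (c + x) \<partial>lebesgue)" .
qed

section \<open>Concatenation of paths\<close>

definition path_concat :: "real \<Rightarrow> (real \<Rightarrow> 'a) \<Rightarrow> (real \<Rightarrow> 'a) \<Rightarrow> real \<Rightarrow> 'a" where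
  "path_concat T \<phi> \<psi> t = (if t \<le> T then \<phi> t else \<psi> (t - T))"

lemma tv_tendsto_cong:
  assumes "\<forall>\<^sub>F x in F. f x = g x"
  shows "tv_tendsto f \<xi> F \<longleftrightarrow> tv_tendsto g \<xi> F"
  unfolding tv_tendsto_def by (rule tendsto_cong) (use assms in eventually_elim, simp)

text \<open>Near each time one of the two paths decides: right limits at \<open>t \<ge> T\<close>
  and left limits at \<open>t > T\<close> come from \<psi>, all others from \<phi>. Right continuity
  at the junction uses \<open>\<phi> T = \<psi> 0\<close>.\<close>

lemma path_concat_skorokhod:
  assumes \<phi>: "\<phi> \<in> skorokhod_paths T" and \<psi>: "\<psi> \<in> skorokhod_paths T'"
    and T: "0 < T" "0 < T'" and eq: "\<phi> T = \<psi> 0"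
  shows "path_concat T \<phi> \<psi> \<in> skorokhod_paths (T + T')"
  unfolding skorokhod_paths_def
proof (intro CollectI conjI allI impI)
  fix t assume t: "0 \<le> t \<and> t < T + T'"
  show "tv_tendsto (path_concat T \<phi> \<psi>) (path_concat T \<phi> \<psi> t) (at_right t)"
  proof (cases "t < T")
    case True
    have "\<forall>\<^sub>F s in at_right t. path_concat T \<phi> \<psi> s = \<phi> s"
      by (intro eventually_at_rightI[OF _ True]) (simp add: path_concat_def)
    moreover have "tv_tendsto \<phi> (\<phi> t) (at_right t)"
      using \<phi> t True by (auto simp: skorokhod_paths_def)
    ultimately show ?thesis
      using True by (simp add: tv_tendsto_cong path_concat_def)
  next
    case False
    have "\<forall>\<^sub>F s in at_right t. path_concat T \<phi> \<psi> s = \<psi> (s - T)"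
      by (intro eventually_at_rightI[of t "t + 1"]) (use False in \<open>auto simp: path_concat_def\<close>)
    moreover have "tv_tendsto \<psi> (\<psi> (t - T)) (at_right (t - T))"
      using \<psi> t False by (auto simp: skorokhod_paths_def)
    then have "tv_tendsto (\<lambda>s. \<psi> (s - T)) (\<psi> (t - T)) (at_right t)"
      unfolding tv_tendsto_def filtermap_at_right_shift[symmetric] by (simp add: filterlim_filtermap)
    moreover have "path_concat T \<phi> \<psi> t = \<psi> (t - T)"
      using False eq by (auto simp: path_concat_def)
    ultimately show ?thesis
      by (simp add: tv_tendsto_cong)
  qed
next
  fix t assume t: "0 < t \<and> t \<le> T + T'"
  show "\<exists>\<xi>. tv_tendsto (path_concat T \<phi> \<psi>) \<xi> (at_left t)"
  proof (cases "t \<le> T")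
    case True
    have "\<forall>\<^sub>F s in at_left t. path_concat T \<phi> \<psi> s = \<phi> s"
      by (intro eventually_at_leftI[of "t - 1"]) (use True in \<open>auto simp: path_concat_def\<close>)
    moreover have "\<exists>\<xi>. tv_tendsto \<phi> \<xi> (at_left t)"
      using \<phi> t True by (auto simp: skorokhod_paths_def)
    ultimately show ?thesis
      by (simp add: tv_tendsto_cong)
  next
    case False
    have "\<forall>\<^sub>F s in at_left t. path_concat T \<phi> \<psi> s = \<psi> (s - T)"
      by (intro eventually_at_leftI[of T]) (use False in \<open>auto simp: path_concat_def\<close>)
    moreover have "\<exists>\<xi>. tv_tendsto \<psi> \<xi> (at_left (t - T))"
      using \<psi> t False unfolding skorokhod_paths_def mem_Collect_eq
      by (elim conjE allE[of _ "t - T"]) simp_all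
    then obtain \<xi> where "tv_tendsto \<psi> \<xi> (at_left (t - T))" ..
    then have "tv_tendsto (\<lambda>s. \<psi> (s - T)) \<xi> (at_left t)"
      unfolding tv_tendsto_def filtermap_at_left_shift[symmetric] by (simp add: filterlim_filtermap)
    ultimately show ?thesis
      by (auto simp: tv_tendsto_cong)
  qed
qed

text \<open>The concatenation is the first path frozen after \<open>T\<close>, plus the second path
  frozen at its initial value before \<open>T\<close>, minus the common value at the
  junction.\<close>

lemma path_concat_abs_cont_on:
  assumes \<phi>: "abs_cont_on 0 T (\<lambda>t. F (\<phi> t))" and \<psi>: "abs_cont_on 0 T' (\<lambda>t. F (\<psi> t))"
    and T: "0 < T" "0 < T'" and eq: "\<phi> T = \<psi> 0"
  shows "abs_cont_on 0 (T + T') (\<lambda>t. F (path_concat T \<phi> \<psi> t))"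
proof -
  have "abs_cont_on 0 (T + T') (\<lambda>t. F (\<phi> (min t T)))"
    using T by (intro abs_cont_on_compose[OF \<phi>]) auto
  moreover have "abs_cont_on 0 (T + T') (\<lambda>t. F (\<psi> (max (t - T) 0)))"
    using T by (intro abs_cont_on_compose[OF \<psi>]) auto
  moreover have "abs_cont_on 0 (T + T') (\<lambda>t. - F (\<phi> T))"
    by (rule abs_cont_on_lipschitz[of _ _ _ 0]) simp
  ultimately have "abs_cont_on 0 (T + T')
      (\<lambda>t. F (\<phi> (min t T)) + F (\<psi> (max (t - T) 0)) + (- F (\<phi> T)))"
    by (intro abs_cont_on_add)
  also have "(\<lambda>t. F (\<phi> (min t T)) + F (\<psi> (max (t - T) 0)) + (- F (\<phi> T)))
      = (\<lambda>t. F (path_concat T \<phi> \<psi> t))"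
    using eq by (auto simp: path_concat_def min_def max_def fun_eq_iff)
  finally show ?thesis .
qed

lemma deriv_shift_left: "deriv (\<lambda>s. f (s - c)) (c + x) = deriv f (x :: real)"
proof -
  \<comment> \<open>The equivalence for every \<open>D\<close> makes the two choices in
    \<open>deriv\<close> coincide, also where no derivative exists.\<close>
  have "DERIV (\<lambda>s. f (s - c)) (c + x) :> D \<longleftrightarrow> DERIV f x :> D" for D
    using DERIV_shift[of "\<lambda>s. f (s - c)" D x c] by (simp add: add.commute)
  then show ?thesis
    by (simp add: deriv_def)
qed

lemma action_path_concat_le:
  assumes T: "0 < T" "0 < T'" and eq: "\<phi> T = \<psi> 0"
  shows "action lam (T + T') \<nu> (path_concat T \<phi> \<psi>) \<le> action lam T \<nu> \<phi> + action lam T' (\<psi> 0) \<psi>"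
proof (cases "\<phi> 0 = \<nu> \<and> (\<forall>z. abs_cont_on 0 T (\<lambda>t. pmf (\<phi> t) z))
    \<and> (\<forall>z. abs_cont_on 0 T' (\<lambda>t. pmf (\<psi> t) z))")
  case False
  then show ?thesis by (auto simp: action_def)
next
  case True
  let ?G = "\<lambda>\<phi> t. e2ennreal (local_rate lam (\<phi> t) (\<lambda>z. deriv (\<lambda>s. pmf (\<phi> s) z) t))"
  let ?c = "path_concat T \<phi> \<psi>"
  have ac: "\<forall>z. abs_cont_on 0 (T + T') (\<lambda>t. pmf (?c t) z)"
    using True path_concat_abs_cont_on[of T "\<lambda>p. pmf p z" \<phi> T' \<psi> for z] T eq by auto
  have c0: "?c 0 = \<nu>"
    using True T by (simp add: path_concat_def)
  have "{0..T + T'} = {0..T} \<union> {T<..T + T'}"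
    using T by auto
  then have "action lam (T + T') \<nu> ?c = (\<integral>\<^sup>+t\<in>{0..T} \<union> {T<..T + T'}. ?G ?c t \<partial>lebesgue)"
    using ac c0 by (simp add: action_def)
  also have "\<dots> \<le> (\<integral>\<^sup>+t\<in>{0..T}. ?G ?c t \<partial>lebesgue) + (\<integral>\<^sup>+t\<in>{T<..T + T'}. ?G ?c t \<partial>lebesgue)"
    by (rule nn_integral_Un_le) auto
  also have "(\<integral>\<^sup>+t\<in>{0..T}. ?G ?c t \<partial>lebesgue) \<le> (\<integral>\<^sup>+t\<in>{0..T}. ?G \<phi> t \<partial>lebesgue)"
  proof (rule nn_integral_mono_AE)
    \<comment> \<open>At the junction the concatenation may have a different derivative than \<phi>,
      so this single time is removed.\<close>
    have "AE t in lebesgue. t \<noteq> T"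
      by (intro AE_completion AE_lborel_singleton)
    then show "AE t in lebesgue. ?G ?c t * indicator {0..T} t \<le> ?G \<phi> t * indicator {0..T} t"
    proof eventually_elim
      case (elim t)
      show ?case
      proof (cases "t < T")
        case True
        then have "\<forall>\<^sub>F s in nhds t. ?c s = \<phi> s"
          by (intro eventually_nhds_in_open[of "{..<T}", THEN eventually_mono])
            (auto simp: path_concat_def)
        then have "\<forall>z. \<forall>\<^sub>F s in nhds t. pmf (?c s) z = pmf (\<phi> s) z"
          by (auto elim: eventually_mono)
        then have "deriv (\<lambda>s. pmf (?c s) z) t = deriv (\<lambda>s. pmf (\<phi> s) z) t" for z
          by (intro deriv_cong_ev) auto
        then show ?thesis
          using True by (simp add: path_concat_def)
      qed (use elim in auto)
    qed
  qed
  also have "(\<integral>\<^sup>+t\<in>{T<..T + T'}. ?G ?c t \<partial>lebesgue)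
      \<le> (\<integral>\<^sup>+t. ?G ?c (T + t) * indicator {T<..T + T'} (T + t) \<partial>lebesgue)"
    by (rule nn_integral_lebesgue_shift_le)
  also have "\<dots> \<le> (\<integral>\<^sup>+t\<in>{0..T'}. ?G \<psi> t \<partial>lebesgue)"
  proof (rule nn_integral_mono)
    fix t
    show "?G ?c (T + t) * indicator {T<..T + T'} (T + t) \<le> ?G \<psi> t * indicator {0..T'} t"
    proof (cases "0 < t")
      case True
      then have "\<forall>\<^sub>F s in nhds (T + t). ?c s = \<psi> (s - T)"
        by (intro eventually_nhds_in_open[of "{T<..}", THEN eventually_mono])
          (auto simp: path_concat_def)
      then have "\<forall>z. \<forall>\<^sub>F s in nhds (T + t). pmf (?c s) z = pmf (\<psi> (s - T)) z"
        by (auto elim: eventually_mono)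
      then have "deriv (\<lambda>s. pmf (?c s) z) (T + t) = deriv (\<lambda>s. pmf (\<psi> (s - T)) z) (T + t)" for z
        by (intro deriv_cong_ev) auto
      also have "\<dots> z = deriv (\<lambda>s. pmf (\<psi> s) z) t" for z
        by (rule deriv_shift_left)
      finally show ?thesis
        using True by (simp add: path_concat_def indicator_def)
    qed simp
  qed
  finally show ?thesis
    using True by (simp add: action_def add_left_mono add_right_mono)
qed

text \<open>Every path admissible for \<open>\<psi> 0\<close> is prolonged by \<psi> to one
  admissible for \<open>\<psi> T'\<close>.\<close>

lemma quasipotential_le_add_action:
  assumes "0 < T'" "\<psi> \<in> skorokhod_paths T'"
  shows "quasipotential lam \<nu> (\<psi> T') \<le> quasipotential lam \<nu> (\<psi> 0) + action lam T' (\<psi> 0) \<psi>"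
proof (cases "action lam T' (\<psi> 0) \<psi> = \<top>")
  case False
  let ?V = "quasipotential lam \<nu> (\<psi> T')" and ?c = "action lam T' (\<psi> 0) \<psi>"
  \<comment> \<open>Moving the cost to the left leaves a bound that passes to the infimum.
    Finiteness of \<open>?c\<close> excludes the case \<infinity> - \<infinity>.\<close>
  have "?V - ?c \<le> quasipotential lam \<nu> (\<psi> 0)"
    unfolding quasipotential_def[of _ _ "\<psi> 0"]
  proof (rule Inf_greatest)
    fix x assume "x \<in> {action lam T \<nu> \<phi> |T \<phi>. T > 0 \<and> \<phi> \<in> skorokhod_paths T \<and> \<phi> 0 = \<nu> \<and> \<phi> T = \<psi> 0}"
    then obtain T \<phi> where T: "0 < T" and \<phi>: "\<phi> \<in> skorokhod_paths T" "\<phi> 0 = \<nu>" "\<phi> T = \<psi> 0"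
      and x: "x = action lam T \<nu> \<phi>"
      by blast
    have "?V \<le> action lam (T + T') \<nu> (path_concat T \<phi> \<psi>)"
      unfolding quasipotential_def
    proof (rule Inf_lower, intro CollectI exI conjI)
      show "path_concat T \<phi> \<psi> \<in> skorokhod_paths (T + T')"
        using assms T \<phi> by (intro path_concat_skorokhod) auto
    qed (use assms T \<phi> in \<open>auto simp: path_concat_def\<close>)
    also have "\<dots> \<le> action lam T \<nu> \<phi> + ?c"
      using assms T \<phi> by (intro action_path_concat_le) auto
    finally show "?V - ?c \<le> x"
      using False by (simp add: x ennreal_minus_le_iff add.commute)
  qed
  then show ?thesis
    using False by (simp add: ennreal_minus_le_iff add.commute)
qed simp

section \<open>Bounding the local rate by edge fluxes\<close>

text \<open>\<open>a z\<close> is the flux along the edge \<open>(z, Suc z)\<close> and \<open>b z\<close> the flux along \<open>(Suc z, 0)\<close>.\<close>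

definition flux_div :: "(nat \<Rightarrow> real) \<Rightarrow> (nat \<Rightarrow> real) \<Rightarrow> nat \<Rightarrow> real" where
  "flux_div a b z = (case z of 0 \<Rightarrow> suminf b - a 0 | Suc k \<Rightarrow> a k - a (Suc k) - b k)"

text \<open>Summation by parts: a flux along an edge is paired with the increment of \<alpha> along
  that edge. The finite support of \<alpha> removes the boundary term at infinity.\<close>

lemma sum_flux_div:
  assumes fin: "finite {z. \<alpha> z \<noteq> 0}" and b: "summable b"
  shows "(\<Sum>z | \<alpha> z \<noteq> 0. \<alpha> z * flux_div a b z)
    = (\<Sum>z. a z * (\<alpha> (Suc z) - \<alpha> z)) + (\<Sum>z. b z * (\<alpha> 0 - \<alpha> (Suc z)))"
proof -
  obtain N where "\<forall>z\<in>{z. \<alpha> z \<noteq> 0}. z < N"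
    using fin unfolding finite_nat_set_iff_bounded by blast
  then have N: "\<alpha> z = 0" if "N \<le> z" for z
    using that by force
  have "(\<Sum>z. a z * (\<alpha> (Suc z) - \<alpha> z)) = (\<Sum>z<N. a z * (\<alpha> (Suc z) - \<alpha> z))"
    using N by (intro suminf_finite) auto
  also have "\<dots> = (\<Sum>z<N. a z * \<alpha> (Suc z)) - (\<Sum>z<N. a z * \<alpha> z)"
    by (simp add: algebra_simps sum_subtractf)
  \<comment> \<open>The added term vanishes since \<open>\<alpha> N = 0\<close>; after splitting off
    index 0, both sums run over \<open>z < N\<close>.\<close>
  also have "(\<Sum>z<N. a z * \<alpha> z) = (\<Sum>z<Suc N. a z * \<alpha> z)"
    using N by simp
  also have "\<dots> = a 0 * \<alpha> 0 + (\<Sum>z<N. a (Suc z) * \<alpha> (Suc z))"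
    by (rule sum.lessThan_Suc_shift)
  finally have 1: "(\<Sum>z. a z * (\<alpha> (Suc z) - \<alpha> z))
      = (\<Sum>z<N. a z * \<alpha> (Suc z)) - (a 0 * \<alpha> 0 + (\<Sum>z<N. a (Suc z) * \<alpha> (Suc z)))" .
  have "(\<lambda>z. b z * \<alpha> (Suc z)) sums (\<Sum>z<N. b z * \<alpha> (Suc z))"
    using N by (intro sums_finite) auto
  then have "(\<lambda>z. b z * \<alpha> 0 - b z * \<alpha> (Suc z)) sums (suminf b * \<alpha> 0 - (\<Sum>z<N. b z * \<alpha> (Suc z)))"
    using b by (intro sums_diff sums_mult2 summable_sums)
  then have 2: "(\<Sum>z. b z * (\<alpha> 0 - \<alpha> (Suc z))) = suminf b * \<alpha> 0 - (\<Sum>z<N. b z * \<alpha> (Suc z))"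
    by (simp add: sums_iff right_diff_distrib)
  have "(\<Sum>z | \<alpha> z \<noteq> 0. \<alpha> z * flux_div a b z) = (\<Sum>z<Suc N. \<alpha> z * flux_div a b z)"
    using N by (intro sum.mono_neutral_left) (auto simp: not_le[symmetric] intro: le_SucI)
  also have "\<dots> = \<alpha> 0 * (suminf b - a 0) + (\<Sum>z<N. \<alpha> (Suc z) * (a z - a (Suc z) - b z))"
    by (subst sum.lessThan_Suc_shift) (simp add: flux_div_def)
  also have "\<dots> = \<alpha> 0 * (suminf b - a 0) + (\<Sum>z<N. a z * \<alpha> (Suc z))
      - (\<Sum>z<N. a (Suc z) * \<alpha> (Suc z)) - (\<Sum>z<N. b z * \<alpha> (Suc z))"
    by (simp add: algebra_simps sum_subtractf sum.distrib)
  finally show ?thesis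
    using 1 2 by (simp add: algebra_simps)
qed

text \<open>Parametrises both kinds of edges injectively by all of \<open>nat\<close>, so that a sum
  over \<open>edges\<close> becomes two series.\<close>

lemma edges_eq: "edges = range (\<lambda>z. (z, Suc z)) \<union> range (\<lambda>z. (Suc z, 0))"
proof -
  have "\<exists>k. z = Suc k" if "z \<noteq> 0" for z
    using that by (cases z) auto
  then show ?thesis
    by (auto simp: edges_def)
qed

lemma has_sum_edges:
  fixes F :: "nat \<Rightarrow> nat \<Rightarrow> real"
  assumes "((\<lambda>z. F z (Suc z)) has_sum A) UNIV" "((\<lambda>z. F (Suc z) 0) has_sum B) UNIV"
  shows "((\<lambda>(z, y). F z y) has_sum (A + B)) edges"
  unfolding edges_eq
proof (rule has_sum_Un_disjoint)
  show "((\<lambda>(z, y). F z y) has_sum A) (range (\<lambda>z. (z, Suc z)))"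
    using assms(1) by (subst has_sum_reindex) (auto simp: inj_on_def o_def)
  show "((\<lambda>(z, y). F z y) has_sum B) (range (\<lambda>z. (Suc z, 0)))"
    using assms(2) by (subst has_sum_reindex) (auto simp: inj_on_def o_def)
qed auto

text \<open>Replaces the explicit convex conjugate \<open>a * ln (a / c) - a + c\<close> in the bound of the local rate,
  so that no case distinction at \<open>a = 0\<close> or \<open>c = 0\<close> is needed.\<close>

lemma flux_le_exp:
  fixes a c d p :: real
  assumes "0 \<le> a" "a \<le> exp p * c"
  shows "a * d - c * exp d \<le> a * p"
proof -
  have "a * (d - p) \<le> a * exp (d - p)"
  proof (intro mult_left_mono assms)
    show "d - p \<le> exp (d - p)"
      using exp_ge_add_one_self[of "d - p"] by linarith
  qed
  also have "\<dots> \<le> exp p * c * exp (d - p)"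
    using assms by (intro mult_right_mono) auto
  also have "\<dots> = c * exp d"
    by (simp add: exp_diff)
  finally show ?thesis
    by (simp add: algebra_simps)
qed

section \<open>The McKean-Vlasov flow in terms of fluxes\<close>

locale bounded_rates =
  fixes lam :: "nat \<Rightarrow> nat \<Rightarrow> nat pmf \<Rightarrow> real" and up lo :: real
  assumes lo_pos: "0 < lo"
    and forward: "lo / (real z + 1) \<le> lam z (Suc z) \<eta>" "lam z (Suc z) \<eta> \<le> up / (real z + 1)"
    and backward: "lo \<le> lam (Suc z) 0 \<eta>" "lam (Suc z) 0 \<eta> \<le> up"
begin

lemma up_pos: "0 < up"
  using lo_pos backward[of 0 undefined] by linarith

lemma lam_nonneg: "0 \<le> lam z (Suc z) \<eta>" "0 \<le> lam (Suc z) 0 \<eta>"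
proof -
  have "0 \<le> lo / (real z + 1)" using lo_pos by simp
  then show "0 \<le> lam z (Suc z) \<eta>" using forward(1)[of z \<eta>] by linarith
  show "0 \<le> lam (Suc z) 0 \<eta>" using lo_pos backward(1)[of z \<eta>] by linarith
qed

lemma forward_le_up: "lam z (Suc z) \<eta> \<le> up"
proof -
  have "up / (real z + 1) \<le> up"
    using up_pos by (simp add: field_simps)
  then show ?thesis using forward(2)[of z \<eta>] by linarith
qed

text \<open>Together with \<open>flux_down\<close>, the fluxes of the McKean-Vlasov flow itself,
  indexed as in \<open>flux_div\<close>.\<close>

definition flux_up :: "nat pmf \<Rightarrow> nat \<Rightarrow> real" where
  "flux_up \<eta> z = lam z (Suc z) \<eta> * pmf \<eta> z"

definition flux_down :: "nat pmf \<Rightarrow> nat \<Rightarrow> real" where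
  "flux_down \<eta> z = lam (Suc z) 0 \<eta> * pmf \<eta> (Suc z)"

lemma flux_up_nonneg: "0 \<le> flux_up \<eta> z"
  and flux_down_nonneg: "0 \<le> flux_down \<eta> z"
  by (simp_all add: flux_up_def flux_down_def lam_nonneg)

lemma summable_flux_up: "summable (flux_up \<eta>)" and suminf_flux_up_le: "suminf (flux_up \<eta>) \<le> up"
proof -
  have le: "flux_up \<eta> z \<le> up * pmf \<eta> z" for z
    by (auto simp: flux_up_def intro!: mult_right_mono forward_le_up)
  have s: "(\<lambda>z. up * pmf \<eta> z) sums (up * 1)"
    by (intro sums_mult pmf_sums_1)
  show sm: "summable (flux_up \<eta>)"
    using le s by (intro summable_comparison_test'[OF sums_summable[OF s], of 0])
      (simp add: flux_up_nonneg)
  show "suminf (flux_up \<eta>) \<le> up"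
    using suminf_le[OF le sm sums_summable[OF s]] sums_unique[OF s] by simp
qed

lemma summable_flux_down: "summable (flux_down \<eta>)"
  and suminf_flux_down_le: "suminf (flux_down \<eta>) \<le> up"
proof -
  have le: "flux_down \<eta> z \<le> up * pmf \<eta> (Suc z)" for z
    by (auto simp: flux_down_def intro!: mult_right_mono backward)
  have s: "(\<lambda>z. up * pmf \<eta> (Suc z)) sums (up * (1 - pmf \<eta> 0))"
    using pmf_sums_1 by (intro sums_mult) (simp add: sums_Suc_iff)
  show sm: "summable (flux_down \<eta>)"
    using le s by (intro summable_comparison_test'[OF sums_summable[OF s], of 0])
      (simp add: flux_down_nonneg)
  have "suminf (flux_down \<eta>) \<le> up * (1 - pmf \<eta> 0)"
    using suminf_le[OF le sm sums_summable[OF s]] sums_unique[OF s] by simp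
  also have "\<dots> \<le> up"
    using up_pos by (simp add: algebra_simps)
  finally show "suminf (flux_down \<eta>) \<le> up" .
qed

text \<open>Brings the drift into the same form as a prescribed velocity, so that their difference
  is a difference of fluxes. Column 0 of the rate matrix collects all return edges; every other
  column has just two nonzero entries.\<close>

lemma mv_drift_eq: "mv_drift lam \<eta> z = flux_div (flux_up \<eta>) (flux_down \<eta>) z"
proof (cases z)
  case 0
  have "{y. y \<noteq> 0 \<and> (0, y) \<in> edges} = {Suc 0}"
    by (auto simp: edges_def)
  then have R0: "rate_matrix lam \<eta> 0 0 = - lam 0 (Suc 0) \<eta>"
    by (simp add: rate_matrix_def)
  have RS: "rate_matrix lam \<eta> (Suc k) 0 = lam (Suc k) 0 \<eta>" for k
    by (simp add: rate_matrix_def edges_def)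
  have "((\<lambda>z'. rate_matrix lam \<eta> z' 0 * pmf \<eta> z') has_sum (- flux_up \<eta> 0)) {0}"
    using R0 has_sum_finite[of "{0}" "\<lambda>z'. rate_matrix lam \<eta> z' 0 * pmf \<eta> z'"]
    by (simp add: flux_up_def)
  moreover have "(flux_down \<eta> has_sum suminf (flux_down \<eta>)) UNIV"
    by (intro sums_nonneg_imp_has_sum summable_sums summable_flux_down flux_down_nonneg)
  then have "((\<lambda>z'. rate_matrix lam \<eta> z' 0 * pmf \<eta> z') has_sum suminf (flux_down \<eta>)) (range Suc)"
    by (subst has_sum_reindex) (auto simp: o_def RS flux_down_def[abs_def])
  ultimately have "((\<lambda>z'. rate_matrix lam \<eta> z' 0 * pmf \<eta> z')
      has_sum (- flux_up \<eta> 0 + suminf (flux_down \<eta>))) ({0} \<union> range Suc)"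
    by (rule has_sum_Un_disjoint) auto
  then show ?thesis
    using 0 by (simp add: mv_drift_def flux_div_def infsumI UNIV_nat_eq[symmetric])
next
  case (Suc k)
  have "{y. y \<noteq> Suc k \<and> (Suc k, y) \<in> edges} = {Suc (Suc k), 0}"
    by (auto simp: edges_def)
  then have R1: "rate_matrix lam \<eta> (Suc k) (Suc k) = - (lam (Suc k) (Suc (Suc k)) \<eta> + lam (Suc k) 0 \<eta>)"
    by (simp add: rate_matrix_def)
  have R2: "rate_matrix lam \<eta> k (Suc k) = lam k (Suc k) \<eta>"
    by (simp add: rate_matrix_def edges_def)
  have R3: "mv_drift lam \<eta> z = (\<Sum>\<^sub>\<infinity>z'\<in>{k, Suc k}. rate_matrix lam \<eta> z' z * pmf \<eta> z')"
    unfolding mv_drift_def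
    by (rule infsum_cong_neutral) (auto simp: rate_matrix_def edges_def Suc)
  show ?thesis
    unfolding R3 by (simp add: Suc R1 R2 flux_div_def flux_up_def flux_down_def algebra_simps)
qed

text \<open>Once velocity and drift are flux divergences, the expression under the supremum splits
  into one term per edge, and the increment of \<alpha> along an edge may be treated as a free
  variable. With \<open>c\<close> the free flux and \<open>a\<close> the prescribed one, the term is
  \<open>a * d - c * exp d + c\<close>, at most \<open>a * p + c\<close> by
  \<open>flux_le_exp\<close>. The two families of free fluxes sum to at most
  \<open>2 * up\<close>.\<close>

lemma local_rate_le_flux:
  assumes a: "summable a" "\<And>z. 0 \<le> a z" "\<And>z. a z \<le> exp p * flux_up \<eta> z"
    and b: "summable b" "\<And>z. 0 \<le> b z" "\<And>z. b z \<le> exp p * flux_down \<eta> z"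
  shows "local_rate lam \<eta> (flux_div a b) \<le> ereal (2 * up + p * (suminf a + suminf b))"
  unfolding local_rate_def
proof (rule SUP_least)
  fix \<alpha> assume "\<alpha> \<in> fin_supp_funs"
  then have fin: "finite {z. \<alpha> z \<noteq> 0}"
    by (simp add: fin_supp_funs_def)
  define d where "d z = \<alpha> (Suc z) - \<alpha> z" for z
  define e where "e z = \<alpha> 0 - \<alpha> (Suc z)" for z
  \<comment> \<open>Boundedness of \<alpha> bounds its increments and their images under
    \<open>tau\<close>, which makes all series below converge.\<close>
  have "finite (range \<alpha>)"
    using fin by (intro finite_subset[of "range \<alpha>" "insert 0 (\<alpha> ` {z. \<alpha> z \<noteq> 0})"]) auto
  then obtain C where C: "\<bar>\<alpha> z\<bar> \<le> C" for z
    using finite_imp_bounded[of "range \<alpha>"] by (auto simp: bounded_iff)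
  have de: "\<bar>d z\<bar> \<le> 2 * C" "\<bar>e z\<bar> \<le> 2 * C" for z
    using C[of z] C[of "Suc z"] C[of 0] by (auto simp: d_def e_def abs_le_iff)
  have sm: "summable (\<lambda>z. f z * g z)"
    if f: "summable f" "\<And>z. 0 \<le> f z" and g: "\<And>z. \<bar>g z\<bar> \<le> K" for f g :: "nat \<Rightarrow> real" and K
  proof (rule summable_comparison_test'[OF summable_mult2[OF f(1), of K]])
    show "norm (f z * g z) \<le> f z * K" for z
      using f(2)[of z] g[of z] by (simp add: abs_mult mult_left_mono)
  qed
  have tau: "0 \<le> tau x" for x
    unfolding tau_def using exp_ge_add_one_self[of x] by linarith
  have taub: "\<bar>tau x\<bar> \<le> exp (2 * C) + 2 * C" if "\<bar>x\<bar> \<le> 2 * C" for x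
  proof -
    have "exp x \<le> exp (2 * C)" using that by simp
    then show ?thesis using that tau[of x] unfolding tau_def by linarith
  qed
  note sums = sm[OF a(1,2) de(1)] sm[OF b(1,2) de(2)]
    sm[OF summable_flux_up flux_up_nonneg de(1)] sm[OF summable_flux_down flux_down_nonneg de(2)]
    sm[OF summable_flux_up flux_up_nonneg taub[OF de(1)]]
    sm[OF summable_flux_down flux_down_nonneg taub[OF de(2)]]
  let ?U = "flux_up \<eta>" and ?D = "flux_down \<eta>"
  have "((\<lambda>(z, z'). tau (\<alpha> z' - \<alpha> z) * lam z z' \<eta> * pmf \<eta> z)
      has_sum ((\<Sum>z. ?U z * tau (d z)) + (\<Sum>z. ?D z * tau (e z)))) edges"
    using sums(5,6) tau flux_up_nonneg flux_down_nonneg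
    by (intro has_sum_edges; intro sums_nonneg_imp_has_sum)
      (simp_all add: sums_iff flux_up_def flux_down_def d_def e_def mult_ac tau lam_nonneg)
  then have 1: "(\<Sum>\<^sub>\<infinity>(z, z')\<in>edges. tau (\<alpha> z' - \<alpha> z) * lam z z' \<eta> * pmf \<eta> z)
      = (\<Sum>z. ?U z * tau (d z)) + (\<Sum>z. ?D z * tau (e z))"
    by (rule infsumI)
  have "(\<Sum>z | \<alpha> z \<noteq> 0. \<alpha> z * (flux_div a b z - mv_drift lam \<eta> z))
      = (\<Sum>z | \<alpha> z \<noteq> 0. \<alpha> z * flux_div a b z) - (\<Sum>z | \<alpha> z \<noteq> 0. \<alpha> z * flux_div ?U ?D z)"
    by (simp add: mv_drift_eq algebra_simps sum_subtractf)
  also have "\<dots> = (\<Sum>z. a z * d z) + (\<Sum>z. b z * e z) - ((\<Sum>z. ?U z * d z) + (\<Sum>z. ?D z * e z))"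
    using fin b(1) by (simp add: sum_flux_div summable_flux_down d_def e_def)
  finally have 2: "(\<Sum>z | \<alpha> z \<noteq> 0. \<alpha> z * (flux_div a b z - mv_drift lam \<eta> z)) = \<dots>" .
  \<comment> \<open>The linear part of \<open>tau\<close> cancels the drift term
    \<open>g z * h z\<close>; what remains is estimated termwise by
    \<open>flux_le_exp\<close>.\<close>
  have edge: "(\<Sum>z. f z * h z) - (\<Sum>z. g z * h z) - (\<Sum>z. g z * tau (h z)) \<le> p * suminf f + suminf g"
    if "summable f" "summable g" "summable (\<lambda>z. f z * h z)" "summable (\<lambda>z. g z * h z)"
      "summable (\<lambda>z. g z * tau (h z))" "\<And>z. 0 \<le> f z" "\<And>z. f z \<le> exp p * g z"
    for f g h :: "nat \<Rightarrow> real"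
  proof -
    have "(\<Sum>z. f z * h z) - (\<Sum>z. g z * h z) - (\<Sum>z. g z * tau (h z))
        = (\<Sum>z. f z * h z - g z * h z - g z * tau (h z))"
      using that by (simp add: suminf_diff summable_diff)
    also have "\<dots> \<le> (\<Sum>z. p * f z + g z)"
    proof (rule suminf_le)
      show "f z * h z - g z * h z - g z * tau (h z) \<le> p * f z + g z" for z
        using flux_le_exp[OF that(6,7), of z "h z"] by (simp add: tau_def algebra_simps)
    qed (use that in \<open>auto intro!: summable_diff summable_add summable_mult\<close>)
    also have "\<dots> = p * suminf f + suminf g"
      using that by (simp add: suminf_add[symmetric] suminf_mult summable_mult)
    finally show ?thesis .
  qed
  have "(\<Sum>z. a z * d z) - (\<Sum>z. ?U z * d z) - (\<Sum>z. ?U z * tau (d z)) \<le> p * suminf a + suminf ?U"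
    using sums a by (intro edge summable_flux_up)
  moreover have "(\<Sum>z. b z * e z) - (\<Sum>z. ?D z * e z) - (\<Sum>z. ?D z * tau (e z)) \<le> p * suminf b + suminf ?D"
    using sums b by (intro edge summable_flux_down)
  ultimately show "ereal ((\<Sum>z | \<alpha> z \<noteq> 0. \<alpha> z * (flux_div a b z - mv_drift lam \<eta> z))
      - (\<Sum>\<^sub>\<infinity>(z, z')\<in>edges. tau (\<alpha> z' - \<alpha> z) * lam z z' \<eta> * pmf \<eta> z))
      \<le> ereal (2 * up + p * (suminf a + suminf b))"
    unfolding 1 2 using suminf_flux_up_le[of \<eta>] suminf_flux_down_le[of \<eta>]
    by (simp add: algebra_simps)
qed

end

section \<open>The weighted distance\<close>

text \<open>Gives continuity at the right endpoint of the antiderivative in the next lemma, which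
  contains \<open>(b - t) * ln (b - t)\<close>.\<close>

lemma continuous_on_x_ln_x: "continuous_on {0..} (\<lambda>x::real. x * ln x)"
  unfolding continuous_on_def
proof
  fix x :: real assume x: "x \<in> {0..}"
  show "((\<lambda>x. x * ln x) \<longlongrightarrow> x * ln x) (at x within {0..})"
  proof (cases "x = 0")
    case False
    then show ?thesis
      using x by (intro tendsto_intros) auto
  next
    case True
    \<comment> \<open>Applying \<open>ln x \<le> x - 1\<close> to \<open>1 / sqrt y\<close> rather
      than to \<open>1 / y\<close> leaves a factor \<open>sqrt y\<close> that tends to 0.\<close>
    have "\<bar>y * ln y\<bar> \<le> 2 * sqrt y" if "0 < y" "y < 1" for y :: real
    proof -
      have "ln (1 / sqrt y) \<le> 1 / sqrt y"
        using that ln_le_minus_one[of "1 / sqrt y"] by simp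
      then have "- ln y \<le> 2 / sqrt y"
        using that by (simp add: ln_div ln_sqrt)
      then have "y * (- ln y) \<le> y * (2 / sqrt y)"
        using that by (intro mult_left_mono) auto
      also have "\<dots> = 2 * (y / sqrt y)"
        by simp
      also have "y / sqrt y = sqrt y"
        using that by (intro real_div_sqrt) simp
      finally show ?thesis
        using that by (simp add: abs_mult)
    qed
    then have "\<forall>\<^sub>F y in at 0 within {0..}. norm (y * ln y) \<le> 2 * sqrt y"
      unfolding eventually_at by (intro exI[of _ 1]) (auto simp: dist_real_def)
    moreover have "((\<lambda>y. 2 * sqrt y) \<longlongrightarrow> 0) (at 0 within {0..})"
      by (auto intro!: tendsto_eq_intros)
    ultimately have "((\<lambda>y::real. y * ln y) \<longlongrightarrow> 0) (at 0 within {0..})"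
      by (rule Lim_null_comparison)
    then show ?thesis
      using True by simp
  qed
qed

text \<open>The integrand has an integrable logarithmic singularity at \<open>b\<close> and the
  explicit antiderivative \<open>F\<close>. The condition \<open>b - a \<le> K\<close> keeps the
  logarithm nonnegative, so the integral in \<open>ennreal\<close> agrees with the real one.\<close>

lemma nn_integral_ln_inverse_le:
  fixes a b c d K :: real
  assumes "a < b" "b - a \<le> K" "0 \<le> c" "0 \<le> d"
  shows "(\<integral>\<^sup>+t\<in>{a<..<b}. ennreal (c + d * ln (K / (b - t))) \<partial>lborel)
    \<le> ennreal ((b - a) * c + (b - a) * d * (ln (K / (b - a)) + 1))"
proof -
  have K: "0 < K" using assms by simp
  define G where "G t = (b - t) * ln (b - t)" for t
  define F where "F t = c * t - d * ((b - t) * (ln K + 1) - G t)" for t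
  have "((\<lambda>t. c + d * ln (K / (b - t))) has_integral (F b - F a)) {a..b}"
  \<comment> \<open>Differentiability is available only inside the interval, because of the
    singularity at \<open>b\<close>; continuity of \<open>F\<close> suffices at the
    endpoints.\<close>
  proof (rule fundamental_theorem_of_calculus_interior)
    have "continuous_on {a..b} G"
      unfolding G_def
      by (rule continuous_on_compose2[OF continuous_on_x_ln_x, of "{a..b}" "\<lambda>t. b - t"])
        (auto intro!: continuous_intros)
    then show "continuous_on {a..b} F"
      unfolding F_def by (intro continuous_intros)
    fix t assume t: "t \<in> {a<..<b}"
    have "(G has_real_derivative - ln (b - t) - 1) (at t)"
      unfolding G_def using t by (auto intro!: derivative_eq_intros)
    then have "(F has_real_derivative c - d * (- (ln K + 1) - (- ln (b - t) - 1))) (at t)"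
      unfolding F_def by (auto intro!: derivative_eq_intros)
    also have "c - d * (- (ln K + 1) - (- ln (b - t) - 1)) = c + d * ln (K / (b - t))"
      using t K by (simp add: ln_div algebra_simps)
    finally show "(F has_vector_derivative c + d * ln (K / (b - t))) (at t)"
      unfolding has_real_derivative_iff_has_vector_derivative .
  qed (use assms in auto)
  moreover have "F b - F a = (b - a) * c + (b - a) * d * (ln (K / (b - a)) + 1)"
    using assms K by (simp add: F_def G_def ln_div algebra_simps)
  moreover have "0 \<le> c + d * ln (K / (b - t))" if "t \<in> {a..b}" for t
  \<comment> \<open>At \<open>t = b\<close> the integrand equals \<open>c\<close>, since division by
    0 and \<open>ln 0\<close> both yield 0.\<close>
  proof (cases "t = b")
    case False
    then have "1 \<le> K / (b - t)" using that assms by simp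
    then show ?thesis using assms by simp
  qed (use assms in simp)
  ultimately have "(\<integral>\<^sup>+t\<in>{a..b}. ennreal (c + d * ln (K / (b - t))) \<partial>lborel)
      = ennreal ((b - a) * c + (b - a) * d * (ln (K / (b - a)) + 1))"
    by (intro nn_integral_has_integral_lebesgue') auto
  moreover have "(\<integral>\<^sup>+t\<in>{a<..<b}. ennreal (c + d * ln (K / (b - t))) \<partial>lborel)
      \<le> (\<integral>\<^sup>+t\<in>{a..b}. ennreal (c + d * ln (K / (b - t))) \<partial>lborel)"
    by (intro nn_integral_mono) (auto simp: indicator_def)
  ultimately show ?thesis by simp
qed

section \<open>Weights comparable to z log z\<close>

lemma vartheta_nonneg: "0 \<le> vartheta z"
  by (cases z) (auto simp: vartheta_def)

lemma Suc_le_vartheta: "real z + 1 \<le> 3 * (1 + vartheta z)"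
proof (cases "z = 0")
  case False
  then have "ln (1 / real z) \<le> 1 / real z - 1"
    by (intro ln_le_minus_one) simp
  then have "real z * (1 - 1 / real z) \<le> real z * ln (real z)"
    using False by (intro mult_left_mono) (auto simp: ln_div)
  then have "real z - 1 \<le> vartheta z"
    using False by (simp add: vartheta_def algebra_simps)
  moreover have "real z \<ge> 1" using False by simp
  ultimately show ?thesis by simp
qed (simp add: vartheta_def)

text \<open>The left side is the order of the logarithmic costs accumulated over stages 0 to
  \<open>z\<close>. For \<open>z \<ge> 2\<close> one has \<open>z + 2 \<le> z * z\<close> and
  \<open>z + 1 \<le> 3 / 2 * z\<close>; \<open>vartheta\<close> vanishes at 0 and 1, where the
  summand 1 is needed.\<close>

lemma Suc_ln_le_vartheta: "(real z + 1) * ln (real z + 2) \<le> 3 * (1 + vartheta z)"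
proof -
  consider "z = 0" | "z = 1" | "2 \<le> z" by linarith
  then show ?thesis
  proof cases
    case 1
    then show ?thesis
      using ln_le_minus_one[of 2] by (simp add: vartheta_def)
  next
    case 2
    \<comment> \<open>The claim for \<open>z = 1\<close> is \<open>2 * ln 3 \<le> 3\<close>.
      Applying \<open>ln x \<le> x - 1\<close> directly to 3 is too weak, whereas the two factors
      give \<open>1 / 2 + 1\<close>.\<close>
    have "ln (3 / 2 * 2) = ln (3 / 2) + ln (2 :: real)"
      by (rule ln_mult_pos) auto
    then show ?thesis
      using 2 ln_le_minus_one[of "3/2"] ln_le_minus_one[of 2] by (simp add: vartheta_def)
  next
    case 3
    have "real z + 2 \<le> real z * 2"
      using 3 by simp
    also have "\<dots> \<le> real z * real z"
      using 3 by (intro mult_left_mono) auto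
    finally have "ln (real z + 2) \<le> ln (real z * real z)"
      using 3 by (subst ln_le_cancel_iff) auto
    then have ln: "ln (real z + 2) \<le> 2 * ln (real z)"
      using 3 by (simp add: ln_mult)
    have "(real z + 1) * ln (real z + 2) \<le> (3 / 2 * real z) * (2 * ln (real z))"
      using 3 ln by (intro mult_mono) auto
    then show ?thesis
      by (simp add: vartheta_def)
  qed
qed

definition weighted_dist :: "nat pmf \<Rightarrow> nat pmf \<Rightarrow> ennreal" where
  "weighted_dist \<nu> \<eta> = (\<integral>\<^sup>+z. ennreal (\<bar>pmf \<nu> z - pmf \<eta> z\<bar> * (1 + vartheta z)) \<partial>count_space UNIV)"

lemma weighted_dist_commute: "weighted_dist \<nu> \<eta> = weighted_dist \<eta> \<nu>"
  by (simp add: weighted_dist_def abs_minus_commute)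

lemma vartheta_mean_eq: "vartheta_mean \<xi> = (\<integral>\<^sup>+z. ennreal (pmf \<xi> z * vartheta z) \<partial>count_space UNIV)"
  by (simp add: vartheta_mean_def nn_integral_measure_pmf ennreal_mult vartheta_nonneg)

text \<open>Under counting measure the functions \<open>?f p\<close> have L1 norm
  \<open>1 + vartheta_mean p\<close>. Pointwise convergence together with convergence of these norms
  gives L1 convergence.\<close>

lemma weighted_dist_tendsto_0:
  assumes fin: "\<And>n. vartheta_mean (\<xi>n n) < \<infinity>" "vartheta_mean \<xi> < \<infinity>"
    and tv: "tv_tendsto \<xi>n \<xi> sequentially"
    and mom: "(\<lambda>n. vartheta_mean (\<xi>n n)) \<longlonglongrightarrow> vartheta_mean \<xi>"
  shows "(\<lambda>n. weighted_dist (\<xi>n n) \<xi>) \<longlonglongrightarrow> 0"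
proof -
  let ?f = "\<lambda>p z. pmf p z * (1 + vartheta z)"
  have norm: "(\<integral>\<^sup>+z. norm (?f p z) \<partial>count_space UNIV) = 1 + vartheta_mean p" for p
  proof -
    have "(\<integral>\<^sup>+z. norm (?f p z) \<partial>count_space UNIV)
        = (\<integral>\<^sup>+z. ennreal (pmf p z) + ennreal (pmf p z * vartheta z) \<partial>count_space UNIV)"
      by (intro nn_integral_cong) (simp add: vartheta_nonneg ennreal_plus[symmetric] algebra_simps del: ennreal_plus)
    also have "\<dots> = 1 + vartheta_mean p"
      by (subst nn_integral_add) (auto simp: vartheta_mean_eq nn_integral_pmf_eq_1)
    finally show ?thesis .
  qed
  have "(\<lambda>n. \<integral>\<^sup>+z. norm (?f (\<xi>n n) z - ?f \<xi> z) \<partial>count_space UNIV) \<longlonglongrightarrow> 0"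
  proof (rule Scheffe_lemma1)
    show "integrable (count_space UNIV) (?f (\<xi>n n))" for n
      using fin(1)[of n] norm[of "\<xi>n n"] by (simp add: integrable_iff_bounded)
    show "integrable (count_space UNIV) (?f \<xi>)"
      using fin(2) norm[of \<xi>] by (simp add: integrable_iff_bounded)
    show "AE z in count_space UNIV. (\<lambda>n. ?f (\<xi>n n) z) \<longlonglongrightarrow> ?f \<xi> z"
      using tv by (auto simp: tv_tendsto_iff_pmf intro!: AE_I2 tendsto_intros)
    have "(\<lambda>n. 1 + vartheta_mean (\<xi>n n)) \<longlonglongrightarrow> 1 + vartheta_mean \<xi>"
      using mom by (intro tendsto_intros)
    then show "limsup (\<lambda>n. \<integral>\<^sup>+z. norm (?f (\<xi>n n) z) \<partial>count_space UNIV)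
        \<le> (\<integral>\<^sup>+z. norm (?f \<xi> z) \<partial>count_space UNIV)"
      unfolding norm by (simp add: lim_imp_Limsup)
  qed
  moreover have "norm (?f p z - ?f q z) = \<bar>pmf p z - pmf q z\<bar> * (1 + vartheta z)" for p q z
  proof -
    have "?f p z - ?f q z = (pmf p z - pmf q z) * (1 + vartheta z)"
      by (simp add: algebra_simps)
    then show ?thesis
      using vartheta_nonneg[of z] by (simp add: abs_mult)
  qed
  ultimately show ?thesis
    by (simp add: weighted_dist_def)
qed

section \<open>The transport path\<close>

locale transport =
  fixes \<nu> \<eta> :: "nat pmf" and T :: real
  assumes T_pos: "0 < T"
begin

text \<open>State 0 is exempt: a surplus there is already where stage 0 collects mass, and it leaves
  along the edge \<open>(0, 1)\<close>.\<close>

definition excess :: "nat \<Rightarrow> real" where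
  "excess z = (if z = 0 then 0 else max 0 (pmf \<nu> z - pmf \<eta> z))"

definition deficit :: "nat \<Rightarrow> real" where
  "deficit z = max 0 (pmf \<eta> z - pmf \<nu> z)"

text \<open>\<open>moved j\<close> is the mass transported in stage \<open>j\<close>: stage 0 empties the excess into 0, stage \<open>Suc k\<close> uses
  the edge \<open>(k, Suc k)\<close>.\<close>

definition moved :: "nat \<Rightarrow> real" where
  "moved j = (case j of 0 \<Rightarrow> suminf excess | Suc k \<Rightarrow> (\<Sum>i. deficit (i + j)))"

text \<open>Closed form of the partial sums of \<open>stage_length\<close>; infinitely many stages
  accumulate at \<open>T\<close>.\<close>

definition stage_start :: "nat \<Rightarrow> real" where
  "stage_start j = T * (real j / (real j + 1))"

definition stage_length :: "nat \<Rightarrow> real" where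
  "stage_length j = T / ((real j + 1) * (real j + 2))"

definition progress :: "nat \<Rightarrow> real \<Rightarrow> real" where
  "progress j t = max 0 (min 1 ((t - stage_start j) / stage_length j))"

text \<open>Initial mass, minus the excess dropped so far, plus inflow, minus outflow along the
  forward edge. Stage \<open>z\<close> is exactly the one that feeds state \<open>z\<close>, also
  for \<open>z = 0\<close>, where the inflow is the collected excess.\<close>

definition mass :: "real \<Rightarrow> nat \<Rightarrow> real" where
  "mass t z = pmf \<nu> z - excess z * progress 0 t + moved z * progress z t
     - moved (Suc z) * progress (Suc z) t"

definition mass_path :: "real \<Rightarrow> nat pmf" where
  "mass_path t = embed_pmf (mass t)"

lemma excess_0 [simp]: "excess 0 = 0"
  by (simp add: excess_def)

lemma excess_nonneg: "0 \<le> excess z" and deficit_nonneg: "0 \<le> deficit z"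
  by (simp_all add: excess_def deficit_def)

lemma excess_le: "excess z \<le> pmf \<nu> z" and deficit_le: "deficit z \<le> pmf \<eta> z"
  by (simp_all add: excess_def deficit_def)

lemma excess_le_diff: "excess z \<le> \<bar>pmf \<nu> z - pmf \<eta> z\<bar>"
  and deficit_le_diff: "deficit z \<le> \<bar>pmf \<nu> z - pmf \<eta> z\<bar>"
  by (auto simp: excess_def deficit_def)

lemma summable_excess: "summable excess" and summable_deficit: "summable deficit"
proof -
  show "summable excess"
    by (rule summable_comparison_test'[OF sums_summable[OF pmf_sums_1[of \<nu>]], of 0])
      (simp add: excess_le excess_nonneg)
  show "summable deficit"
    by (rule summable_comparison_test'[OF sums_summable[OF pmf_sums_1[of \<eta>]], of 0])
      (simp add: deficit_le deficit_nonneg)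
qed

lemma moved_nonneg: "0 \<le> moved j"
proof (cases j)
  case 0
  then show ?thesis
    by (simp add: moved_def excess_nonneg suminf_nonneg summable_excess)
next
  case (Suc k)
  have "summable (\<lambda>i. deficit (i + j))"
    using summable_deficit summable_iff_shift by blast
  then show ?thesis
    unfolding moved_def using Suc by (simp add: deficit_nonneg suminf_nonneg)
qed

lemma moved_Suc: "moved (Suc k) = deficit (Suc k) + moved (Suc (Suc k))"
proof -
  have "summable (\<lambda>i. deficit (i + Suc k))"
    using summable_deficit summable_iff_shift by blast
  from suminf_split_head[OF this] show ?thesis
    by (simp add: moved_def)
qed

text \<open>Both measures have total mass 1, so total excess minus total deficit over the positive
  states is the difference of the masses at 0.\<close>

lemma moved_balance: "pmf \<nu> 0 + moved 0 = pmf \<eta> 0 + moved 1"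
proof -
  have "(\<lambda>z. pmf \<nu> (Suc z) - pmf \<eta> (Suc z)) sums ((1 - pmf \<nu> 0) - (1 - pmf \<eta> 0))"
    using pmf_sums_1[of \<nu>] pmf_sums_1[of \<eta>] by (intro sums_diff) (simp_all add: sums_Suc_iff)
  moreover have "excess (Suc z) - deficit (Suc z) = pmf \<nu> (Suc z) - pmf \<eta> (Suc z)" for z
    by (simp add: excess_def deficit_def)
  moreover have "(\<lambda>z. excess (Suc z) - deficit (Suc z)) sums (moved 0 - moved 1)"
  proof (intro sums_diff)
    show "(\<lambda>z. excess (Suc z)) sums moved 0"
      using summable_sums[OF summable_excess] by (simp add: sums_Suc_iff moved_def)
    have "summable (\<lambda>z. deficit (Suc z))"
      using summable_deficit by (simp add: summable_Suc_iff)
    then show "(\<lambda>z. deficit (Suc z)) sums moved 1"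
      by (simp add: moved_def summable_sums)
  qed
  ultimately have "(1 - pmf \<nu> 0) - (1 - pmf \<eta> 0) = moved 0 - moved 1"
    using sums_unique2 by simp
  then show ?thesis by simp
qed

lemma moved_tendsto_0: "moved \<longlonglongrightarrow> 0"
proof -
  have "(\<lambda>k. \<Sum>i. deficit (i + Suc k)) \<longlonglongrightarrow> 0"
    using suminf_exist_split2[OF summable_deficit] by (rule LIMSEQ_Suc)
  then have "(\<lambda>k. moved (Suc k)) \<longlonglongrightarrow> 0"
    by (simp add: moved_def)
  then show ?thesis
    by (simp add: filterlim_sequentially_Suc)
qed

lemma stage_length_pos: "0 < stage_length j"
  using T_pos by (simp add: stage_length_def)

lemma stage_start_Suc: "stage_start (Suc j) = stage_start j + stage_length j"
proof -
  have "(real j + 1) / (real j + 2) = real j / (real j + 1) + 1 / ((real j + 1) * (real j + 2))"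
    by (simp add: divide_simps) (simp add: algebra_simps)
  then have "T * ((real j + 1) / (real j + 2)) = T * (real j / (real j + 1) + 1 / ((real j + 1) * (real j + 2)))"
    by simp
  then show ?thesis
    by (simp add: stage_start_def stage_length_def algebra_simps)
qed

lemma stage_start_mono: "i \<le> j \<Longrightarrow> stage_start i \<le> stage_start j"
  by (rule lift_Suc_mono_le[of stage_start]) (auto simp: stage_start_Suc less_imp_le stage_length_pos)

lemma stage_start_0 [simp]: "stage_start 0 = 0"
  by (simp add: stage_start_def)

lemma stage_start_nonneg: "0 \<le> stage_start j"
  using stage_start_mono[of 0 j] by simp

lemma stage_start_less: "stage_start j < T"
  using T_pos by (simp add: stage_start_def field_simps)

lemma stage_start_tendsto: "stage_start \<longlonglongrightarrow> T"
proof -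
  have "(\<lambda>n. T * (real n / real (Suc n))) \<longlonglongrightarrow> T * 1"
    by (intro tendsto_intros LIMSEQ_n_over_Suc_n)
  then show ?thesis
    by (simp add: stage_start_def[abs_def] add.commute)
qed

lemma stage_length_sums: "stage_length sums T"
proof -
  have "(\<lambda>j. stage_start (Suc j) - stage_start j) sums (T - stage_start 0)"
    by (rule telescope_sums[OF stage_start_tendsto])
  then show ?thesis
    by (simp add: stage_start_Suc)
qed

lemma progress_nonneg: "0 \<le> progress j t" and progress_le_1: "progress j t \<le> 1"
  by (simp_all add: progress_def)

lemma progress_eq_0: "t \<le> stage_start j \<Longrightarrow> progress j t = 0"
  using stage_length_pos[of j] divide_nonpos_pos[of "t - stage_start j" "stage_length j"]
  by (simp add: progress_def)

lemma progress_eq_1: "stage_start (Suc j) \<le> t \<Longrightarrow> progress j t = 1"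
  using stage_length_pos[of j] by (simp add: progress_def stage_start_Suc field_simps min_def max_def)

lemma progress_stage:
  "stage_start j \<le> t \<Longrightarrow> t \<le> stage_start (Suc j) \<Longrightarrow> progress j t = (t - stage_start j) / stage_length j"
  using stage_length_pos[of j] by (simp add: progress_def stage_start_Suc field_simps min_def max_def)

lemma progress_before:
  assumes "progress j t \<noteq> 0" "i < j"
  shows "progress i t = 1"
proof (rule progress_eq_1)
  have "stage_start (Suc i) \<le> stage_start j"
    using assms by (intro stage_start_mono) simp
  moreover have "stage_start j < t"
    using assms progress_eq_0[of t j] by force
  ultimately show "stage_start (Suc i) \<le> t" by simp
qed

lemma progress_lipschitz: "\<bar>progress j t - progress j s\<bar> \<le> \<bar>t - s\<bar> / stage_length j"
proof -
  have "\<bar>progress j t - progress j s\<bar>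
      \<le> \<bar>(t - stage_start j) / stage_length j - (s - stage_start j) / stage_length j\<bar>"
    unfolding progress_def by linarith
  also have "\<dots> = \<bar>t - s\<bar> / stage_length j"
    using stage_length_pos[of j] by (simp add: diff_divide_distrib[symmetric] abs_divide)
  finally show ?thesis .
qed

text \<open>When stage \<open>Suc z\<close> begins, state \<open>z\<close> has received everything
  destined for the states beyond it, by \<open>moved_balance\<close> or \<open>moved_Suc\<close>. So
  the source always holds at least the mass still to be sent, which bounds its free flux from
  below.\<close>

lemma moved_le_mass:
  assumes "progress 0 t = 1" "progress z t = 1"
  shows "moved (Suc z) * (1 - progress (Suc z) t) \<le> mass t z"
proof (cases z)
  case 0
  have "moved 1 \<le> pmf \<nu> 0 + moved 0"
    using moved_balance by simp
  then show ?thesis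
    using 0 assms by (simp add: mass_def algebra_simps)
next
  case (Suc k)
  then show ?thesis
    using assms moved_Suc[of k] deficit_nonneg[of "Suc k"] excess_le[of "Suc k"]
    by (simp add: mass_def algebra_simps)
qed

text \<open>The counterpart for stage 0: as long as nothing has left \<open>z\<close> along its
  forward edge, the excess not yet dropped is still there.\<close>

lemma excess_le_mass:
  assumes "progress (Suc z) t = 0"
  shows "excess z * (1 - progress 0 t) \<le> mass t z"
  using assms excess_le[of z] moved_nonneg[of z] progress_nonneg[of z t]
  by (simp add: mass_def algebra_simps add_increasing2)

text \<open>Either stage \<open>Suc z\<close> has not begun and only excess has left
  \<open>z\<close>, or all earlier stages are complete.\<close>

lemma mass_nonneg: "0 \<le> mass t z"
proof (cases "progress (Suc z) t = 0")
  case True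
  have "0 \<le> excess z * (1 - progress 0 t)"
    using excess_nonneg progress_le_1 by simp
  then show ?thesis
    using excess_le_mass[OF True] by linarith
next
  case False
  have "0 \<le> moved (Suc z) * (1 - progress (Suc z) t)"
    using moved_nonneg progress_le_1 by simp
  then show ?thesis
    using moved_le_mass[of t z] progress_before[OF False, of 0] progress_before[OF False, of z] by simp
qed

text \<open>Inflow and outflow telescope, with no mass lost at infinity because \<open>moved\<close>
  tends to 0. The remaining \<open>moved 0 * progress 0 t\<close> at state 0 balances the dropped
  excess.\<close>

lemma mass_sums: "mass t sums 1"
proof -
  have "(\<lambda>z. moved z * progress z t) \<longlonglongrightarrow> 0"
  proof (rule Lim_null_comparison[OF _ moved_tendsto_0])
    show "\<forall>\<^sub>F z in sequentially. norm (moved z * progress z t) \<le> moved z"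
      using moved_nonneg progress_nonneg progress_le_1
      by (intro always_eventually) (auto simp: abs_mult mult_left_le)
  qed
  from telescope_sums'[OF this]
  have "(\<lambda>z. moved z * progress z t - moved (Suc z) * progress (Suc z) t) sums (moved 0 * progress 0 t)"
    by simp
  moreover have "(\<lambda>z. pmf \<nu> z - excess z * progress 0 t) sums (1 - moved 0 * progress 0 t)"
    using summable_excess by (auto simp: moved_def intro!: sums_diff pmf_sums_1 sums_mult2 summable_sums)
  ultimately have "(\<lambda>z. (pmf \<nu> z - excess z * progress 0 t)
      + (moved z * progress z t - moved (Suc z) * progress (Suc z) t))
      sums ((1 - moved 0 * progress 0 t) + moved 0 * progress 0 t)"
    by (intro sums_add)
  then show ?thesis
    by (simp add: mass_def[abs_def] algebra_simps)
qed

lemma pmf_path: "pmf (mass_path t) z = mass t z"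
  unfolding mass_path_def
proof (rule pmf_embed_pmf)
  have "(\<lambda>z. ennreal (mass t z)) sums ennreal 1"
    using mass_sums[of t] mass_nonneg by (subst sums_ennreal) auto
  then show "(\<integral>\<^sup>+z. ennreal (mass t z) \<partial>count_space UNIV) = 1"
    by (simp add: nn_integral_count_space_nat sums_iff)
qed (rule mass_nonneg)

lemma path_0: "mass_path 0 = \<nu>"
  by (rule pmf_eqI) (simp add: pmf_path mass_def progress_eq_0 stage_start_nonneg)

lemma path_T: "mass_path T = \<eta>"
proof (rule pmf_eqI)
  fix z
  have "progress j T = 1" for j
    by (intro progress_eq_1 less_imp_le stage_start_less)
  then have "pmf (mass_path T) z = pmf \<nu> z - excess z + moved z - moved (Suc z)"
    by (simp add: pmf_path mass_def)
  also have "\<dots> = pmf \<eta> z"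
  proof (cases z)
    case 0
    then show ?thesis using moved_balance by simp
  next
    case (Suc k)
    then show ?thesis using moved_Suc[of k] by (simp add: excess_def deficit_def)
  qed
  finally show "pmf (mass_path T) z = pmf \<eta> z" .
qed

text \<open>The constant depends on \<open>z\<close> through the shrinking stage lengths.
  Coordinatewise bounds suffice for absolute continuity and, by \<open>tv_tendsto_iff_pmf\<close>,
  for continuity in total variation.\<close>

lemma path_lipschitz:
  "\<bar>pmf (mass_path t) z - pmf (mass_path s) z\<bar> \<le> (excess z / stage_length 0 + moved z / stage_length z
     + moved (Suc z) / stage_length (Suc z)) * \<bar>t - s\<bar>"
proof -
  have *: "\<bar>m * progress j t - m * progress j s\<bar> \<le> m / stage_length j * \<bar>t - s\<bar>" if "0 \<le> m" for m j
  proof -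
    have "\<bar>m * progress j t - m * progress j s\<bar> = m * \<bar>progress j t - progress j s\<bar>"
      using that by (simp add: abs_mult right_diff_distrib[symmetric])
    also have "\<dots> \<le> m * (\<bar>t - s\<bar> / stage_length j)"
      by (intro mult_left_mono progress_lipschitz that)
    finally show ?thesis by simp
  qed
  have "\<bar>pmf (mass_path t) z - pmf (mass_path s) z\<bar>
      \<le> \<bar>excess z * progress 0 t - excess z * progress 0 s\<bar>
        + \<bar>moved z * progress z t - moved z * progress z s\<bar>
        + \<bar>moved (Suc z) * progress (Suc z) t - moved (Suc z) * progress (Suc z) s\<bar>"
    unfolding pmf_path mass_def by linarith
  also have "\<dots> \<le> excess z / stage_length 0 * \<bar>t - s\<bar> + moved z / stage_length z * \<bar>t - s\<bar>
     + moved (Suc z) / stage_length (Suc z) * \<bar>t - s\<bar>"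
    by (intro add_mono * excess_nonneg moved_nonneg)
  finally show ?thesis
    by (simp add: distrib_right)
qed

lemma path_abs_cont_on: "abs_cont_on a b (\<lambda>t. pmf (mass_path t) z)"
proof (rule abs_cont_on_lipschitz)
  fix u v :: real assume "u < v"
  then show "\<bar>pmf (mass_path v) z - pmf (mass_path u) z\<bar> \<le> (excess z / stage_length 0 + moved z / stage_length z
     + moved (Suc z) / stage_length (Suc z)) * (v - u)"
    using path_lipschitz[of v z u] by simp
qed

lemma path_tv_tendsto: "tv_tendsto mass_path (mass_path t) (at t within S)"
  unfolding tv_tendsto_iff_pmf
proof
  fix z
  let ?C = "excess z / stage_length 0 + moved z / stage_length z + moved (Suc z) / stage_length (Suc z)"
  have "((\<lambda>s. ?C * \<bar>s - t\<bar>) \<longlongrightarrow> ?C * \<bar>t - t\<bar>) (at t within S)"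
    by (intro tendsto_intros)
  then have "((\<lambda>s. ?C * \<bar>s - t\<bar>) \<longlongrightarrow> 0) (at t within S)"
    by simp
  then have "((\<lambda>s. pmf (mass_path s) z - pmf (mass_path t) z) \<longlongrightarrow> 0) (at t within S)"
    by (rule Lim_null_comparison[rotated]) (auto intro!: always_eventually path_lipschitz)
  then show "((\<lambda>s. pmf (mass_path s) z) \<longlongrightarrow> pmf (mass_path t) z) (at t within S)"
    by (rule LIM_zero_cancel)
qed

lemma path_skorokhod: "mass_path \<in> skorokhod_paths T"
  using path_tv_tendsto by (auto simp: skorokhod_paths_def)

section \<open>Velocity of the transport path as a flux divergence\<close>

lemma deriv_progress:
  assumes t: "stage_start j < t" "t < stage_start (Suc j)"
  shows "((\<lambda>s. progress i s) has_real_derivative (if i = j then 1 / stage_length j else 0)) (at t)"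
proof -
  have ev: "\<forall>\<^sub>F s in nhds t. stage_start j < s \<and> s < stage_start (Suc j)"
    using t eventually_nhds_in_open[of "{stage_start j<..<stage_start (Suc j)}" t] by simp
  consider "i < j" | "i = j" | "j < i" by linarith
  then show ?thesis
  proof cases
    case 1
    have "\<forall>\<^sub>F s in nhds t. progress i s = 1"
      using ev
    proof eventually_elim
      case (elim s)
      then show ?case
        using stage_start_mono[of "Suc i" j] 1 by (intro progress_eq_1) simp
    qed
    then have "((\<lambda>s. progress i s) has_real_derivative 0) (at t) \<longleftrightarrow> ((\<lambda>_. 1) has_real_derivative 0) (at t)"
      by (intro DERIV_cong_ev) auto
    then show ?thesis using 1 by simp
  next
    case 2
    have "\<forall>\<^sub>F s in nhds t. progress i s = (s - stage_start j) / stage_length j"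
      using ev by eventually_elim (auto simp: 2 progress_stage)
    then have "((\<lambda>s. progress i s) has_real_derivative (1 / stage_length j)) (at t)
        \<longleftrightarrow> ((\<lambda>s. (s - stage_start j) / stage_length j) has_real_derivative (1 / stage_length j)) (at t)"
      by (intro DERIV_cong_ev) auto
    moreover have "((\<lambda>s. (s - stage_start j) / stage_length j) has_real_derivative (1 / stage_length j)) (at t)"
      by (intro DERIV_cdivide) (auto intro!: derivative_eq_intros)
    ultimately show ?thesis using 2 by simp
  next
    case 3
    have "\<forall>\<^sub>F s in nhds t. progress i s = 0"
      using ev
    proof eventually_elim
      case (elim s)
      then show ?case
        using stage_start_mono[of "Suc j" i] 3 by (intro progress_eq_0) simp
    qed
    then have "((\<lambda>s. progress i s) has_real_derivative 0) (at t) \<longleftrightarrow> ((\<lambda>_. 0) has_real_derivative 0) (at t)"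
      by (intro DERIV_cong_ev) auto
    then show ?thesis using 3 by simp
  qed
qed

definition stage_up :: "nat \<Rightarrow> nat \<Rightarrow> real" where
  "stage_up j z = (if Suc z = j then moved j / stage_length j else 0)"

definition stage_down :: "nat \<Rightarrow> nat \<Rightarrow> real" where
  "stage_down j z = (if j = 0 then excess (Suc z) / stage_length j else 0)"

lemma stage_up_sums: "stage_up j sums (if j = 0 then 0 else moved j / stage_length j)"
proof (cases j)
  case 0
  then show ?thesis by (simp add: stage_up_def[abs_def])
next
  case (Suc k)
  then have "stage_up j = (\<lambda>z. if z = k then moved j / stage_length j else 0)"
    by (auto simp: stage_up_def)
  then show ?thesis
    using Suc sums_single[of k "\<lambda>_. moved j / stage_length j"] by simp
qed

lemma stage_down_sums: "stage_down j sums (if j = 0 then moved j / stage_length j else 0)"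
proof (cases j)
  case 0
  have "(\<lambda>z. excess (Suc z)) sums moved 0"
    using summable_sums[OF summable_excess] by (simp add: sums_Suc_iff moved_def)
  then show ?thesis
    using 0 by (simp add: stage_down_def[abs_def] sums_divide)
qed (simp add: stage_down_def[abs_def])

lemma deriv_path:
  assumes t: "stage_start j < t" "t < stage_start (Suc j)"
  shows "deriv (\<lambda>s. pmf (mass_path s) z) t = flux_div (stage_up j) (stage_down j) z"
proof -
  let ?r = "\<lambda>i. if i = j then 1 / stage_length j else 0"
  have "((\<lambda>s. pmf \<nu> z - excess z * progress 0 s + moved z * progress z s
      - moved (Suc z) * progress (Suc z) s) has_real_derivative
      (0 - excess z * ?r 0 + moved z * ?r z - moved (Suc z) * ?r (Suc z))) (at t)"
    by (intro DERIV_diff DERIV_add DERIV_cmult deriv_progress[OF t] DERIV_const)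
  then have "deriv (\<lambda>s. pmf (mass_path s) z) t = - excess z * ?r 0 + moved z * ?r z - moved (Suc z) * ?r (Suc z)"
    by (auto simp: pmf_path mass_def[abs_def] dest: DERIV_imp_deriv)
  also have "\<dots> = flux_div (stage_up j) (stage_down j) z"
    \<comment> \<open>At state 0 the divergence contains the total return flux, which in stage 0
      equals \<open>moved 0 / stage_length 0\<close>.\<close>
    using sums_unique[OF stage_down_sums[of j]]
    by (auto simp: flux_div_def stage_up_def stage_down_def split: nat.split)
  finally show ?thesis .
qed

text \<open>The stage boundaries and \<open>T\<close> form a countable, hence null, set. Any other
  time in the interval lies just before the first stage start exceeding it.\<close>

lemma AE_in_stage:
  "AE t in lborel. t \<in> {0..T} \<longrightarrow> (\<exists>j. stage_start j < t \<and> t < stage_start (Suc j))"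
proof -
  have "insert T (range stage_start) \<in> null_sets lborel"
    by (intro countable_imp_null_set_lborel) simp
  then have "AE t in lborel. t \<notin> insert T (range stage_start)"
    by (rule AE_not_in)
  then show ?thesis
  proof eventually_elim
    case (elim t)
    show ?case
    proof
      assume "t \<in> {0..T}"
      then have t: "0 < t" "t < T"
        using elim rangeI[of stage_start 0] by (auto simp: less_le)
      then have "\<exists>j. t < stage_start j"
        using order_tendstoD(1)[OF stage_start_tendsto t(2)] by (auto simp: eventually_sequentially)
      then obtain j where j: "t < stage_start j" and least: "\<And>i. i < j \<Longrightarrow> \<not> t < stage_start i"
        using exists_least_iff[of "\<lambda>j. t < stage_start j"] by blast
      from j t obtain k where k: "j = Suc k"
        by (cases j) auto
      have "stage_start k < t"
        using least[of k] elim k by (auto simp: not_less less_le)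
      then show "\<exists>j. stage_start j < t \<and> t < stage_start (Suc j)"
        using j k by blast
    qed
  qed
qed

end

section \<open>Cost of the transport path and continuity\<close>

text \<open>The condition \<open>lo * T \<le> 1\<close> gives
  \<open>stage_length j \<le> (real j + 1) / lo\<close>, so that the logarithms in the stage costs
  are nonnegative.\<close>

locale bounded_transport = bounded_rates lam up lo + transport \<nu> \<eta> T
  for lam up lo \<nu> \<eta> T +
  assumes small: "lo * T \<le> 1"
begin

lemma local_rate_path_le:
  assumes t: "stage_start j < t" "t < stage_start (Suc j)"
  shows "local_rate lam (mass_path t) (\<lambda>z. deriv (\<lambda>s. pmf (mass_path s) z) t)
    \<le> ereal (2 * up + moved j / stage_length j * ln ((real j + 1) / lo / (stage_start (Suc j) - t)))"
proof -
  let ?l = "stage_length j" and ?r = "stage_start (Suc j) - t"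
  \<comment> \<open>\<open>exp p\<close> bounds the ratio of required to free flux. The former is
    \<open>moved j / ?l\<close>, the source holds at least \<open>moved j * ?r / ?l\<close>, and the
    rate is at least \<open>lo / j\<close>, or \<open>lo\<close> in stage 0. Using
    \<open>j + 1\<close> covers both cases.\<close>
  define p where "p = ln ((real j + 1) / lo / ?r)"
  have r: "0 < ?r" and l: "0 < ?l"
    using t stage_length_pos by auto
  have p: "exp p = (real j + 1) / lo / ?r"
    unfolding p_def using r lo_pos by (subst exp_ln) auto
  have rest: "1 - progress j t = ?r / ?l"
    using t l by (simp add: progress_stage stage_start_Suc field_simps)
  have cancel: "a / lo / r * (lo / b * (m * (r / l))) = a / b * (m / l)"
    if "r \<noteq> 0" for a b m r l :: real
    using that lo_pos by simp
  have up_le: "stage_up j z \<le> exp p * flux_up (mass_path t) z" for z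
  proof (cases "Suc z = j")
    case True
    have "progress i t = 1" if "i < j" for i
    proof (rule progress_eq_1)
      show "stage_start (Suc i) \<le> t"
        using stage_start_mono[of "Suc i" j] that t by simp
    qed
    then have "moved j * (?r / ?l) \<le> mass t z"
      using moved_le_mass[of t z] True rest by simp
    then have "lo / (real z + 1) * (moved j * (?r / ?l)) \<le> flux_up (mass_path t) z"
      unfolding flux_up_def pmf_path using forward lo_pos moved_nonneg[of j] r l lam_nonneg
      by (intro mult_mono) auto
    then have flux: "exp p * (lo / (real z + 1) * (moved j * (?r / ?l))) \<le> exp p * flux_up (mass_path t) z"
      by (intro mult_left_mono) auto
    have "stage_up j z = 1 * (moved j / ?l)"
      using True by (simp add: stage_up_def)
    also have "\<dots> \<le> (real j + 1) / (real z + 1) * (moved j / ?l)"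
      using True moved_nonneg[of j] l by (intro mult_right_mono) auto
    also have "\<dots> = exp p * (lo / (real z + 1) * (moved j * (?r / ?l)))"
      unfolding p using r by (intro cancel[symmetric]) simp
    also note flux
    finally show ?thesis .
  qed (simp add: stage_up_def flux_up_nonneg)
  have down_le: "stage_down j z \<le> exp p * flux_down (mass_path t) z" for z
  proof (cases "j = 0")
    case True
    have "progress (Suc (Suc z)) t = 0"
      using stage_start_mono[of "Suc j" "Suc (Suc z)"] t True by (intro progress_eq_0) simp
    then have "excess (Suc z) * (?r / ?l) \<le> mass t (Suc z)"
      using excess_le_mass[of "Suc z" t] True rest by simp
    then have "lo * (excess (Suc z) * (?r / ?l)) \<le> flux_down (mass_path t) z"
      unfolding flux_down_def pmf_path using backward lo_pos excess_nonneg[of "Suc z"] r l lam_nonneg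
      by (intro mult_mono) auto
    then have flux: "exp p * (lo * (excess (Suc z) * (?r / ?l))) \<le> exp p * flux_down (mass_path t) z"
      by (intro mult_left_mono) auto
    have "stage_down j z = exp p * (lo * (excess (Suc z) * (?r / ?l)))"
      unfolding p using r lo_pos True by (simp add: stage_down_def)
    also note flux
    finally show ?thesis .
  qed (simp add: stage_down_def flux_down_nonneg)
  have "local_rate lam (mass_path t) (flux_div (stage_up j) (stage_down j))
      \<le> ereal (2 * up + p * (suminf (stage_up j) + suminf (stage_down j)))"
    using up_le down_le moved_nonneg excess_nonneg l
    by (intro local_rate_le_flux sums_summable[OF stage_up_sums] sums_summable[OF stage_down_sums])
      (auto simp: stage_up_def stage_down_def)
  also have "suminf (stage_up j) + suminf (stage_down j) = moved j / ?l"
    unfolding sums_unique[OF stage_up_sums, symmetric] sums_unique[OF stage_down_sums, symmetric] by simp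
  finally show ?thesis
    by (simp add: deriv_path[OF t] p_def mult.commute)
qed

text \<open>The first summand adds up to \<open>2 * up * T\<close> over all stages; the second is
  the price for the transported mass, with a constant that grows as \<open>T\<close>
  shrinks.\<close>

lemma stage_cost_le:
  "(\<integral>\<^sup>+t\<in>{stage_start j<..<stage_start (Suc j)}.
      ennreal (2 * up + moved j / stage_length j * ln ((real j + 1) / lo / (stage_start (Suc j) - t))) \<partial>lborel)
    \<le> ennreal (2 * up * stage_length j) + ennreal (moved j * (3 * ln (real j + 2) + (1 - ln (lo * T))))"
proof -
  let ?l = "stage_length j" and ?K = "(real j + 1) / lo"
  have l: "0 < ?l" by (rule stage_length_pos)
  have "T / ((real j + 1) * (real j + 2)) \<le> T / 1"
    using T_pos by (intro divide_left_mono mult_pos_pos) (auto simp: algebra_simps)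
  then have "?l \<le> T"
    by (simp add: stage_length_def)
  also have "T \<le> 1 / lo"
    using small lo_pos by (simp add: field_simps)
  also have "1 / lo \<le> ?K"
    using lo_pos by (intro divide_right_mono) auto
  finally have lK: "?l \<le> ?K" .
  \<comment> \<open>One factor \<open>j + 1\<close> stems from the decaying rate, the other two
    factors from the stage length; this explains the coefficient 3 of the logarithm.\<close>
  have "ln (?K / ?l) = ln ((real j + 1) * (real j + 1) * (real j + 2) / (lo * T))"
    using lo_pos T_pos by (simp add: stage_length_def field_simps)
  also have "\<dots> = ln (real j + 1) + ln (real j + 1) + ln (real j + 2) - ln (lo * T)"
    using lo_pos T_pos by (simp add: ln_divide_pos ln_mult_pos)
  also have "\<dots> \<le> 3 * ln (real j + 2) - ln (lo * T)"
    by (simp add: ln_mono)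
  finally have ln: "ln (?K / ?l) + 1 \<le> 3 * ln (real j + 2) + (1 - ln (lo * T))"
    by simp
  have ln0: "0 \<le> 3 * ln (real j + 2) + (1 - ln (lo * T))"
  proof -
    have "ln (lo * T) \<le> 0" using small lo_pos T_pos by simp
    then show ?thesis by (simp add: add_nonneg_nonneg)
  qed
  have "(\<integral>\<^sup>+t\<in>{stage_start j<..<stage_start (Suc j)}.
      ennreal (2 * up + moved j / ?l * ln (?K / (stage_start (Suc j) - t))) \<partial>lborel)
    \<le> ennreal ((stage_start (Suc j) - stage_start j) * (2 * up)
      + (stage_start (Suc j) - stage_start j) * (moved j / ?l)
        * (ln (?K / (stage_start (Suc j) - stage_start j)) + 1))"
    using l lK up_pos moved_nonneg[of j] by (intro nn_integral_ln_inverse_le) (auto simp: stage_start_Suc)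
  also have "\<dots> = ennreal (2 * up * ?l + moved j * (ln (?K / ?l) + 1))"
    using l by (simp add: stage_start_Suc mult.commute)
  also have "\<dots> \<le> ennreal (2 * up * ?l + moved j * (3 * ln (real j + 2) + (1 - ln (lo * T))))"
    using ln moved_nonneg[of j] by (intro ennreal_leI add_left_mono mult_left_mono) auto
  also have "\<dots> = ennreal (2 * up * ?l) + ennreal (moved j * (3 * ln (real j + 2) + (1 - ln (lo * T))))"
    using up_pos l moved_nonneg[of j] ln0 by (intro ennreal_plus) auto
  finally show ?thesis .
qed

text \<open>Stage 0 moves excess, later stages move the deficit from \<open>j\<close> on, and both
  are dominated by the absolute difference. The masked form prepares an exchange of summations over
  \<open>j\<close> and \<open>k\<close>.\<close>

lemma moved_le: "ennreal (moved j) \<le> (\<Sum>k. ennreal (if j \<le> k then \<bar>pmf \<nu> k - pmf \<eta> k\<bar> else 0))"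
proof -
  have sums: "(\<lambda>k. ennreal (if j \<le> k then f k else 0)) sums ennreal (\<Sum>i. f (i + j))"
    if "summable f" "\<And>k. 0 \<le> f k" for f
  proof -
    have "summable (\<lambda>i. f (i + j))"
      using that(1) summable_iff_shift by blast
    then have "(\<lambda>i. f (i + j)) sums (\<Sum>i. f (i + j))"
      by (rule summable_sums)
    then have "(\<lambda>k. if j \<le> k then f k else 0) sums (\<Sum>i. f (i + j))"
      using sums_zero_iff_shift[of j "\<lambda>k. if j \<le> k then f k else 0" "\<Sum>i. f (i + j)"] by simp
    then show ?thesis
      using that \<open>summable (\<lambda>i. f (i + j))\<close> by (subst sums_ennreal) (auto intro: suminf_nonneg)
  qed
  obtain f where f: "summable f" "\<And>k. 0 \<le> f k" "\<And>k. f k \<le> \<bar>pmf \<nu> k - pmf \<eta> k\<bar>"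
    and "moved j = (\<Sum>i. f (i + j))"
  proof (cases j)
    case 0
    then show thesis
      using that[of excess] summable_excess excess_nonneg excess_le_diff by (simp add: moved_def)
  next
    case (Suc k)
    then show thesis
      using that[of deficit] summable_deficit deficit_nonneg deficit_le_diff by (simp add: moved_def)
  qed
  then have "ennreal (moved j) = (\<Sum>k. ennreal (if j \<le> k then f k else 0))"
    using sums[OF f(1,2)] by (simp add: sums_iff)
  also have "\<dots> \<le> (\<Sum>k. ennreal (if j \<le> k then \<bar>pmf \<nu> k - pmf \<eta> k\<bar> else 0))"
    using f(3) by (intro suminf_le summableI ennreal_leI) auto
  finally show ?thesis .
qed

text \<open>After the exchange of summations, a discrepancy at \<open>k\<close> is charged once for
  each stage \<open>j \<le> k\<close>. These charges total about \<open>k * ln k\<close>, which is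
  where the weight \<open>1 + vartheta k\<close> comes from.\<close>

lemma sum_moved_le:
  assumes L: "0 \<le> L"
  shows "(\<Sum>j. ennreal (moved j * (3 * ln (real j + 2) + L))) \<le> ennreal (9 + 3 * L) * weighted_dist \<nu> \<eta>"
proof -
  define c where "c j = 3 * ln (real j + 2) + L" for j :: nat
  define \<delta> where "\<delta> k = \<bar>pmf \<nu> k - pmf \<eta> k\<bar>" for k
  have c0: "0 \<le> c j" for j
    using L by (simp add: c_def)
  have sum_c: "(\<Sum>j\<le>k. c j) \<le> (9 + 3 * L) * (1 + vartheta k)" for k
  proof -
    have "(\<Sum>j\<le>k. c j) \<le> of_nat (card {..k}) * c k"
      by (intro sum_bounded_above) (auto simp: c_def intro: ln_mono)
    also have "\<dots> = 3 * ((real k + 1) * ln (real k + 2)) + L * (real k + 1)"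
      by (simp add: c_def algebra_simps)
    also have "\<dots> \<le> 3 * (3 * (1 + vartheta k)) + L * (3 * (1 + vartheta k))"
      by (intro add_mono mult_left_mono Suc_ln_le_vartheta Suc_le_vartheta L) simp
    finally show ?thesis
      by (simp add: algebra_simps)
  qed
  have "(\<Sum>j. ennreal (moved j * c j)) \<le> (\<Sum>j. \<Sum>k. ennreal (c j * (if j \<le> k then \<delta> k else 0)))"
  proof (intro suminf_le summableI)
    fix j
    have "ennreal (moved j * c j) = ennreal (c j) * ennreal (moved j)"
      using c0 moved_nonneg by (simp add: ennreal_mult mult.commute)
    also have "\<dots> \<le> ennreal (c j) * (\<Sum>k. ennreal (if j \<le> k then \<delta> k else 0))"
      unfolding \<delta>_def by (intro mult_left_mono moved_le) simp
    also have "\<dots> = (\<Sum>k. ennreal (c j * (if j \<le> k then \<delta> k else 0)))"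
      unfolding ennreal_suminf_cmult[symmetric] using c0
      by (intro suminf_cong ennreal_mult[symmetric]) (auto simp: \<delta>_def)
    finally show "ennreal (moved j * c j) \<le> \<dots>" .
  qed
  also have "\<dots> = (\<integral>\<^sup>+k. (\<Sum>j. ennreal (c j * (if j \<le> k then \<delta> k else 0))) \<partial>count_space UNIV)"
    by (subst nn_integral_suminf) (simp_all add: nn_integral_count_space_nat)
  also have "\<dots> \<le> (\<integral>\<^sup>+k. ennreal (9 + 3 * L) * ennreal (\<delta> k * (1 + vartheta k)) \<partial>count_space UNIV)"
  proof (rule nn_integral_mono)
    fix k
    have "(\<Sum>j. ennreal (c j * (if j \<le> k then \<delta> k else 0))) = (\<Sum>j\<le>k. ennreal (c j * (if j \<le> k then \<delta> k else 0)))"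
      by (intro suminf_finite) auto
    also have "\<dots> = (\<Sum>j\<le>k. ennreal (c j * \<delta> k))"
      by (intro sum.cong) auto
    also have "\<dots> = ennreal ((\<Sum>j\<le>k. c j) * \<delta> k)"
      using c0 by (simp add: sum_ennreal sum_distrib_right \<delta>_def)
    also have "\<dots> \<le> ennreal ((9 + 3 * L) * (1 + vartheta k) * \<delta> k)"
      by (intro ennreal_leI mult_right_mono sum_c) (simp add: \<delta>_def)
    also have "\<dots> = ennreal ((9 + 3 * L) * (\<delta> k * (1 + vartheta k)))"
      by (simp add: mult_ac)
    also have "\<dots> = ennreal (9 + 3 * L) * ennreal (\<delta> k * (1 + vartheta k))"
      using L vartheta_nonneg[of k] by (intro ennreal_mult) (auto simp: \<delta>_def)
    finally show "(\<Sum>j. ennreal (c j * (if j \<le> k then \<delta> k else 0))) \<le> \<dots>" .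
  qed
  also have "\<dots> = ennreal (9 + 3 * L) * weighted_dist \<nu> \<eta>"
    by (subst nn_integral_cmult) (simp_all add: weighted_dist_def \<delta>_def)
  finally show ?thesis
    by (simp add: c_def)
qed

lemma action_path_le:
  "action lam T \<nu> mass_path
    \<le> ennreal (2 * up * T) + ennreal (9 + 3 * (1 - ln (lo * T))) * weighted_dist \<nu> \<eta>"
proof -
  \<comment> \<open>\<open>B j\<close> is a measurable majorant of the integrand on stage
    \<open>j\<close>, extended by 0, so integral and sum over the stages can be exchanged.\<close>
  define B where "B j t = ennreal (2 * up + moved j / stage_length j
    * ln ((real j + 1) / lo / (stage_start (Suc j) - t))) * indicator {stage_start j<..<stage_start (Suc j)} t" for j t
  let ?G = "\<lambda>t. e2ennreal (local_rate lam (mass_path t) (\<lambda>z. deriv (\<lambda>s. pmf (mass_path s) z) t))"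
  have "action lam T \<nu> mass_path = (\<integral>\<^sup>+t\<in>{0..T}. ?G t \<partial>lborel)"
    by (simp add: action_def path_0 path_abs_cont_on nn_integral_completion)
  also have "\<dots> \<le> (\<integral>\<^sup>+t. (\<Sum>j. B j t) \<partial>lborel)"
  proof (rule nn_integral_mono_AE)
    show "AE t in lborel. ?G t * indicator {0..T} t \<le> (\<Sum>j. B j t)"
      using AE_in_stage
    proof eventually_elim
      case (elim t)
      show ?case
      proof (cases "t \<in> {0..T}")
        case True
        then obtain j where j: "stage_start j < t" "t < stage_start (Suc j)"
          using elim by blast
        have "?G t \<le> B j t"
          using e2ennreal_mono[OF local_rate_path_le[OF j]] j by (simp add: B_def)
        also have "\<dots> \<le> (\<Sum>j. B j t)"
          using sum_le_suminf[of "\<lambda>j. B j t" "{j}"] by simp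
        finally show ?thesis
          using True by simp
      qed simp
    qed
  qed
  also have "\<dots> = (\<Sum>j. \<integral>\<^sup>+t. B j t \<partial>lborel)"
    unfolding B_def by (intro nn_integral_suminf) measurable
  also have "\<dots> \<le> (\<Sum>j. ennreal (2 * up * stage_length j)
      + ennreal (moved j * (3 * ln (real j + 2) + (1 - ln (lo * T)))))"
    unfolding B_def by (intro suminf_le summableI stage_cost_le)
  also have "\<dots> = (\<Sum>j. ennreal (2 * up * stage_length j))
      + (\<Sum>j. ennreal (moved j * (3 * ln (real j + 2) + (1 - ln (lo * T)))))"
    by (intro suminf_add[symmetric] summableI)
  also have "(\<Sum>j. ennreal (2 * up * stage_length j)) = ennreal (2 * up * T)"
  proof -
    have "(\<lambda>j. ennreal (2 * up * stage_length j)) sums ennreal (2 * up * T)"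
      using up_pos stage_length_pos T_pos
      by (subst sums_ennreal) (auto intro!: sums_mult stage_length_sums simp: less_imp_le)
    then show ?thesis by (simp add: sums_iff)
  qed
  also have "(\<Sum>j. ennreal (moved j * (3 * ln (real j + 2) + (1 - ln (lo * T)))))
      \<le> ennreal (9 + 3 * (1 - ln (lo * T))) * weighted_dist \<nu> \<eta>"
  proof (rule sum_moved_le)
    have "ln (lo * T) \<le> 0" using small lo_pos T_pos by simp
    then show "0 \<le> 1 - ln (lo * T)" by simp
  qed
  finally show ?thesis
    by (simp add: add_left_mono)
qed

end

text \<open>Errors are added on the larger side, which avoids truncated subtraction and covers an
  infinite limit: there the second inequality forces \<open>f n\<close> to be infinite.\<close>

lemma ennreal_tendsto_of_le_add:
  fixes l :: ennreal
  assumes *: "\<And>e. 0 < e \<Longrightarrow> \<forall>\<^sub>F n in F. f n \<le> l + ennreal e \<and> l \<le> f n + ennreal e"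
  shows "(f \<longlongrightarrow> l) F"
proof (cases l)
  case top
  have "\<forall>\<^sub>F n in F. f n = l"
    using *[OF zero_less_one] by eventually_elim (auto simp: top top_unique)
  then show ?thesis
    by (rule tendsto_eventually)
next
  case (real r)
  show ?thesis
  proof (rule order_tendstoI)
    fix a assume "a < l"
    then obtain s where s: "a = ennreal s" "0 \<le> s" "s < r"
      using real by (cases a) (auto simp: ennreal_less_iff)
    have "\<forall>\<^sub>F n in F. l \<le> f n + ennreal ((r - s) / 2)"
      using *[of "(r - s) / 2"] s by (auto elim: eventually_mono)
    then show "\<forall>\<^sub>F n in F. a < f n"
    proof eventually_elim
      case (elim n)
      show ?case
      proof (rule ccontr)
        assume "\<not> a < f n"
        then have "f n + ennreal ((r - s) / 2) \<le> ennreal s + ennreal ((r - s) / 2)"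
          using s by (intro add_right_mono) auto
        with elim have "l \<le> ennreal s + ennreal ((r - s) / 2)"
          by (rule order_trans)
        then have "r \<le> s + (r - s) / 2"
          using s real by (simp add: ennreal_plus[symmetric] del: ennreal_plus)
        then show False
          using s by (simp add: field_simps)
      qed
    qed
  next
    fix a assume a: "l < a"
    obtain e where e: "0 < e" "l + ennreal e < a"
    proof (cases a)
      case top
      then show thesis using real that[of 1] by (simp add: less_top[symmetric])
    next
      case (real s)
      then have "r < s" using a \<open>l = ennreal r\<close> \<open>0 \<le> r\<close> by (simp add: ennreal_less_iff)
      then have "l + ennreal ((s - r) / 2) < a"
        using real \<open>l = ennreal r\<close> \<open>0 \<le> r\<close>
        by (simp add: ennreal_plus[symmetric] ennreal_less_iff field_simps del: ennreal_plus)
      then show thesis using \<open>r < s\<close> that[of "(s - r) / 2"] by simp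
    qed
    show "\<forall>\<^sub>F n in F. f n < a"
      using *[OF e(1)] by eventually_elim (use e(2) in auto)
  qed
qed

section \<open>Continuity of the quasipotential in the weighted distance\<close>

context bounded_rates
begin

lemma quasipotential_le_add_weighted_dist:
  assumes T: "0 < T" "lo * T \<le> 1"
  shows "quasipotential lam \<zeta> \<eta> \<le> quasipotential lam \<zeta> \<nu>
    + (ennreal (2 * up * T) + ennreal (9 + 3 * (1 - ln (lo * T))) * weighted_dist \<nu> \<eta>)"
proof -
  interpret bounded_transport lam up lo \<nu> \<eta> T
    by unfold_locales (use T in auto)
  have "quasipotential lam \<zeta> \<eta> \<le> quasipotential lam \<zeta> \<nu> + action lam T \<nu> mass_path"
    using quasipotential_le_add_action[OF T(1) path_skorokhod, of lam \<zeta>] by (simp add: path_0 path_T)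
  also have "\<dots> \<le> quasipotential lam \<zeta> \<nu>
      + (ennreal (2 * up * T) + ennreal (9 + 3 * (1 - ln (lo * T))) * weighted_dist \<nu> \<eta>)"
    by (intro add_left_mono action_path_le)
  finally show ?thesis .
qed

lemma quasipotential_tendsto:
  assumes "((\<lambda>n. weighted_dist (\<xi>n n) \<xi>) \<longlongrightarrow> 0) F"
  shows "((\<lambda>n. quasipotential lam \<zeta> (\<xi>n n)) \<longlongrightarrow> quasipotential lam \<zeta> \<xi>) F"
proof (rule ennreal_tendsto_of_le_add)
  fix e :: real assume e: "0 < e"
  \<comment> \<open>The order of choices matters: first \<open>T\<close> is taken small enough for
    \<open>2 * up * T \<le> e / 2\<close>. Then \<open>C\<close> is a fixed finite constant, and the
    weighted distance is made small against it.\<close>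
  define T where "T = min (1 / lo) (e / (4 * up))"
  define C where "C = ennreal (9 + 3 * (1 - ln (lo * T)))"
  have T: "0 < T" "lo * T \<le> 1" "2 * up * T \<le> e / 2"
    using e lo_pos up_pos by (auto simp: T_def min_def field_simps)
  have "((\<lambda>n. C * weighted_dist (\<xi>n n) \<xi>) \<longlongrightarrow> C * 0) F"
    using assms by (intro ennreal_tendsto_cmult) (auto simp: C_def)
  then have "\<forall>\<^sub>F n in F. C * weighted_dist (\<xi>n n) \<xi> < ennreal (e / 2)"
    using e by (intro order_tendstoD(2)) auto
  then show "\<forall>\<^sub>F n in F. quasipotential lam \<zeta> (\<xi>n n) \<le> quasipotential lam \<zeta> \<xi> + ennreal e
      \<and> quasipotential lam \<zeta> \<xi> \<le> quasipotential lam \<zeta> (\<xi>n n) + ennreal e"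
  proof eventually_elim
    case (elim n)
    have "ennreal (2 * up * T) + C * weighted_dist (\<xi>n n) \<xi> \<le> ennreal (e / 2) + ennreal (e / 2)"
      using T(3) elim by (intro add_mono ennreal_leI) auto
    also have "\<dots> = ennreal e"
      using e by (simp add: ennreal_plus[symmetric] del: ennreal_plus)
    finally have le: "ennreal (2 * up * T) + C * weighted_dist (\<xi>n n) \<xi> \<le> ennreal e" .
    show ?case
    proof
      show "quasipotential lam \<zeta> (\<xi>n n) \<le> quasipotential lam \<zeta> \<xi> + ennreal e"
        using quasipotential_le_add_weighted_dist[OF T(1,2), of \<zeta> "\<xi>n n" \<xi>] add_left_mono[OF le]
        unfolding C_def weighted_dist_commute[of \<xi> "\<xi>n n"] by (rule order_trans)
      show "quasipotential lam \<zeta> \<xi> \<le> quasipotential lam \<zeta> (\<xi>n n) + ennreal e"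
        using quasipotential_le_add_weighted_dist[OF T(1,2), of \<zeta> \<xi> "\<xi>n n"] add_left_mono[OF le]
        unfolding C_def by (rule order_trans)
    qed
  qed
qed

end

theorem lemma5p3:
  fixes lam :: "nat \<Rightarrow> nat \<Rightarrow> nat pmf \<Rightarrow> real"
    and lam_up lam_lo :: real
    and \<xi>s \<xi> :: "nat pmf"
    and \<xi>n :: "nat \<Rightarrow> nat pmf"
  assumes rates_nonneg: "\<And>z z' \<eta>. (z, z') \<in> edges \<Longrightarrow> 0 \<le> lam z z' \<eta>"
    and consts_pos: "lam_up > 0" "lam_lo > 0"
    and bounds_forward: "\<And>\<eta> z. lam_lo / (real z + 1) \<le> lam z (z + 1) \<eta> \<and>
                                lam z (z + 1) \<eta> \<le> lam_up / (real z + 1)"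
    and bounds_backward: "\<And>\<eta> z. z \<noteq> 0 \<Longrightarrow> lam_lo \<le> lam z 0 \<eta> \<and> lam z 0 \<eta> \<le> lam_up"
    and lipschitz: "\<exists>L\<ge>0. \<forall>\<eta> \<zeta>.
          (\<forall>z. \<bar>(real z + 1) * lam z (z + 1) \<eta> - (real z + 1) * lam z (z + 1) \<zeta>\<bar>
                 \<le> L * tv_dist \<eta> \<zeta>) \<and>
          (\<forall>z. z \<noteq> 0 \<longrightarrow> \<bar>lam z 0 \<eta> - lam z 0 \<zeta>\<bar> \<le> L * tv_dist \<eta> \<zeta>)"
    and stable: "glob_asymp_stable_equilibrium lam \<xi>s"
    and stable_unique: "\<And>\<eta>. glob_asymp_stable_equilibrium lam \<eta> \<Longrightarrow> \<eta> = \<xi>s"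
    and equilibrium_moment: "vartheta_mean \<xi>s < \<infinity>"
    and moment_convergence: "\<And>M::real. M > 0 \<Longrightarrow>
          ((\<lambda>t. SUP \<nu>\<in>K_level M. SUP \<mu>\<in>mv_solutions lam \<nu>. vartheta_mean (\<mu> t))
             \<longlongrightarrow> vartheta_mean \<xi>s) at_top"
    and \<xi>n_in: "\<And>n. n \<ge> 1 \<Longrightarrow> \<xi>n n \<in> K_set"
    and \<xi>_in: "\<xi> \<in> K_set"
    and \<xi>n_tendsto: "tv_tendsto \<xi>n \<xi> sequentially"
    and \<xi>n_moments: "(\<lambda>n. vartheta_mean (\<xi>n n)) \<longlonglongrightarrow> vartheta_mean \<xi>"
  shows "(\<lambda>n. quasipotential lam \<xi>s (\<xi>n n)) \<longlonglongrightarrow> quasipotential lam \<xi>s \<xi>"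
proof -
  interpret bounded_rates lam lam_up lam_lo
  proof
    show "lam_lo / (real z + 1) \<le> lam z (Suc z) \<eta>" "lam z (Suc z) \<eta> \<le> lam_up / (real z + 1)" for z \<eta>
      using bounds_forward[of z \<eta>] by simp_all
    show "lam_lo \<le> lam (Suc z) 0 \<eta>" "lam (Suc z) 0 \<eta> \<le> lam_up" for z \<eta>
      using bounds_backward[of "Suc z" \<eta>] by simp_all
  qed (rule consts_pos)
  have fin: "vartheta_mean p < \<infinity>" if "p \<in> K_set" for p
    using that by (auto simp: K_set_def K_level_def intro: le_less_trans)
  \<comment> \<open>Membership in \<open>K_set\<close> is assumed from index 1 on, so the sequence
    is shifted by one to have finite moments throughout.\<close>
  have "(\<lambda>n. weighted_dist (\<xi>n (Suc n)) \<xi>) \<longlonglongrightarrow> 0"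
  proof (rule weighted_dist_tendsto_0)
    show "tv_tendsto (\<lambda>n. \<xi>n (Suc n)) \<xi> sequentially"
      using \<xi>n_tendsto unfolding tv_tendsto_def by (rule LIMSEQ_Suc)
    show "(\<lambda>n. vartheta_mean (\<xi>n (Suc n))) \<longlonglongrightarrow> vartheta_mean \<xi>"
      using \<xi>n_moments by (rule LIMSEQ_Suc)
  qed (use \<xi>n_in \<xi>_in fin in auto)
  then have "(\<lambda>n. quasipotential lam \<xi>s (\<xi>n (Suc n))) \<longlonglongrightarrow> quasipotential lam \<xi>s \<xi>"
    by (rule quasipotential_tendsto)
  then show ?thesis
    by (rule LIMSEQ_imp_Suc)
qed

end
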